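(* Let $D$ be a skeletal directed acyclic graph. The congruence lattice of $\mathcal{AR}_D$ (congruences ordered by refinement, the finest congruence being the minimum) is isomorphic to the lattice of lower ideals of the subrope order on the ropes of $D$, ordered by reverse inclusion.
   Context: All directed graphs are finite and simple. A reorientation of a directed acyclic graph $D=(V,A)$ is a directed graph with the same underlying undirected graph, encoded by the set of arcs of $D$ that it reverses. $\mathcal{AR}_D$ is the poset of acyclic reorientations of $D$ ordered by inclusion of sets of reversed arcs. The transitive reduction of a directed acyclic graph is obtained by deleting all arcs whose endpoints are connected by a directed path of length at least $2$. A directed graph is a forest if its underlying undirected graph has no cycle. $D$ is vertebrate if the transitive reduction of every induced subgraph of $D$ is a forest; filled if for any directed path $\pi$ in $D$ whose endpoints are joined by an arc of $D$, all arcs joining any two vertices of $\pi$ belong to $D$; skeletal if vertebrate and filled. When $D$ is skeletal, $\mathcal{AR}_D$ is a lattice. A congruence of a lattice is an equivalence relation compatible with meets and joins. The transitive support of an arc $(u,v)$ of $D$ is the set of vertices appearing along directed paths in $D$ from $u$ to $v$. A rope of $D$ is a quadruple $(u,v,\nabla,\Delta)$ where $(u,v)\in A$ and $\nabla\sqcup\Delta$ is a partition of the transitive support of $(u,v)$ minus $\{u,v\}$. A rope $\rho=(u,v,\nabla,\Delta)$ is a subrope of a rope $\rho'=(u',v',\nabla',\Delta')$ if $\{u,v\}\subseteq\{u',v'\}\cup\nabla'\cup\Delta'$, $\nabla\subseteq\nabla'$ and $\Delta\subseteq\Delta'$. The subrope order is the partial order on the ropes of $D$ given by $\rho\prec\rho'$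 if $\rho$ is a subrope of $\rho'$. A lower ideal is a subset closed under taking subropes. *)

theory Defs
  imports "Graph_Theory.Graph_Theory" "HOL-Algebra.Lattice"
begin

section \<open>Skeletal directed acyclic graphs\<close>

text \<open>
  Finite simple directed graphs are elements of the locale \<^locale>\<open>pair_digraph\<close>; a directed
  path is given by its list of vertices (\<^const>\<open>vpath\<close>). The definitions below are meant for
  acyclic graphs, where \<open>(u, v)\<close> and \<open>(v, u)\<close> are never both arcs.
\<close>

definition dag :: "'a pair_pre_digraph \<Rightarrow> bool" where
  "dag D \<longleftrightarrow> pair_digraph D \<and> acyclic (parcs D)"

definition directed_path ::
    "'a pair_pre_digraph \<Rightarrow> 'a \<Rightarrow> 'a list \<Rightarrow> 'a \<Rightarrow> bool" where
  "directed_path D u p v \<longleftrightarrow> vpath p D \<and> hd p = u \<and> last p = v"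

definition transitive_reduction :: "'a pair_pre_digraph \<Rightarrow> 'a pair_pre_digraph" where
  "transitive_reduction D =
     \<lparr> pverts = pverts D,
       parcs = {(u, v) \<in> parcs D. \<not> (\<exists>p. directed_path D u p v \<and> vwalk_length p \<ge> 2)} \<rparr>"

text \<open>
  The underlying undirected graph is the symmetric digraph \<^const>\<open>mk_symmetric\<close>. The library
  constant \<^const>\<open>forest\<close> cannot be used for it, because it regards the walk \<open>u, v, u\<close> along
  an edge and back as a cycle; undirected cycles have length at least 3.
\<close>

definition underlying_forest :: "'a pair_pre_digraph \<Rightarrow> bool" where
  "underlying_forest D \<longleftrightarrow>
     \<not> (\<exists>c. pre_digraph.cycle (with_proj (mk_symmetric (with_proj D))) c \<and> length c \<ge> 3)"

definition vertebrate :: "'a pair_pre_digraph \<Rightarrow> bool" where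
  "vertebrate D \<longleftrightarrow>
     (\<forall>H :: 'a pair_pre_digraph.
        induced_subgraph (with_proj H) (with_proj D) \<longrightarrow> underlying_forest (transitive_reduction H))"

text \<open>
  In an acyclic graph an arc joining two vertices of a path points from the earlier to the
  later one.
\<close>

definition filled :: "'a pair_pre_digraph \<Rightarrow> bool" where
  "filled D \<longleftrightarrow>
     (\<forall>u p v. directed_path D u p v \<and> (u, v) \<in> parcs D \<longrightarrow>
        (\<forall>i j. i < j \<and> j < length p \<longrightarrow> (p ! i, p ! j) \<in> parcs D))"

definition skeletal :: "'a pair_pre_digraph \<Rightarrow> bool" where
  "skeletal D \<longleftrightarrow> vertebrate D \<and> filled D"


section \<open>The poset of acyclic reorientations\<close>

definition reorient :: "'a pair_pre_digraph \<Rightarrow> ('a \<times> 'a) set \<Rightarrow> 'a pair_pre_digraph" where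
  "reorient D R = \<lparr> pverts = pverts D, parcs = (parcs D - R) \<union> R\<inverse> \<rparr>"

definition acyclic_reorientations :: "'a pair_pre_digraph \<Rightarrow> ('a \<times> 'a) set gorder" where
  "acyclic_reorientations D =
     \<lparr> carrier = {R. R \<subseteq> parcs D \<and> acyclic (parcs (reorient D R))}, eq = (=), le = (\<subseteq>) \<rparr>"


section \<open>Congruences and order isomorphisms\<close>

text \<open>
  The values of \<^const>\<open>join\<close> and \<^const>\<open>meet\<close> are meaningful only in a lattice, which is
  therefore part of the definition.
\<close>

definition lattice_congruence :: "('b, 'c) gorder_scheme \<Rightarrow> ('b \<times> 'b) set \<Rightarrow> bool" where
  "lattice_congruence L \<theta> \<longleftrightarrow>
     lattice L \<and> equiv (carrier L) \<theta> \<and>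
     (\<forall>x x' y y'. (x, x') \<in> \<theta> \<and> (y, y') \<in> \<theta> \<longrightarrow>
        (x \<squnion>\<^bsub>L\<^esub> y, x' \<squnion>\<^bsub>L\<^esub> y') \<in> \<theta> \<and> (x \<sqinter>\<^bsub>L\<^esub> y, x' \<sqinter>\<^bsub>L\<^esub> y') \<in> \<theta>)"

definition congruence_lattice :: "('b, 'c) gorder_scheme \<Rightarrow> ('b \<times> 'b) set gorder" where
  "congruence_lattice L =
     \<lparr> carrier = {\<theta>. lattice_congruence L \<theta>}, eq = (=), le = (\<subseteq>) \<rparr>"

text \<open>For lattices, order isomorphisms are the same as lattice isomorphisms.\<close>

definition order_isomorphic :: "('b, 'c) gorder_scheme \<Rightarrow> ('d, 'e) gorder_scheme \<Rightarrow> bool" where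
  "order_isomorphic L M \<longleftrightarrow> (\<exists>f. bij_betw f (carrier L) (carrier M) \<and> order_emb L M f)"


section \<open>Ropes\<close>

definition transitive_support :: "'a pair_pre_digraph \<Rightarrow> 'a \<Rightarrow> 'a \<Rightarrow> 'a set" where
  "transitive_support D u v = {w. \<exists>p. directed_path D u p v \<and> w \<in> set p}"

text \<open>In a rope \<open>(u, v, N, T)\<close>, the letters \<open>N\<close> and \<open>T\<close> stand for nabla and Delta in the usual notation; either
  part may be empty.\<close>

type_synonym 'a rope = "'a \<times> 'a \<times> 'a set \<times> 'a set"

definition ropes :: "'a pair_pre_digraph \<Rightarrow> 'a rope set" where
  "ropes D = {(u, v, N, T). (u, v) \<in> parcs D \<and> N \<inter> T = {} \<and>
                N \<union> T = transitive_support D u v - {u, v}}"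

definition subrope :: "'a rope \<Rightarrow> 'a rope \<Rightarrow> bool" where
  "subrope = (\<lambda>(u, v, N, T) (u', v', N', T').
     {u, v} \<subseteq> {u', v'} \<union> N' \<union> T' \<and> N \<subseteq> N' \<and> T \<subseteq> T')"

definition rope_lower_ideals :: "'a pair_pre_digraph \<Rightarrow> 'a rope set set" where
  "rope_lower_ideals D =
     {I. I \<subseteq> ropes D \<and> (\<forall>\<rho>' \<in> I. \<forall>\<rho> \<in> ropes D. subrope \<rho> \<rho>' \<longrightarrow> \<rho> \<in> I)}"

definition rope_ideal_lattice :: "'a pair_pre_digraph \<Rightarrow> 'a rope set gorder" where
  "rope_ideal_lattice D = \<lparr> carrier = rope_lower_ideals D, eq = (=), le = (\<supseteq>) \<rparr>"

end

theory Submission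
  imports Defs
begin

text \<open>
  Skeletal graphs are chordal, so a reorientation is acyclic iff it creates no directed triangle.
  Acyclic reorientations are therefore the arc sets that are closed and coclosed on triangles, as for
  inversion sets of permutations. A rope \<open>(u, v, N, T)\<close> has the join irreducible \<open>J\<close> of
  the arcs from \<open>{u} \<union> N\<close> to \<open>{v} \<union> T\<close>, and its only lower cover is
  \<open>J - {(u, v)}\<close>. A congruence is sent to the ropes whose join irreducible it does not identify
  with the lower cover; conversely an ideal of ropes identifies two elements that lie above the same
  of its join irreducibles. The latter relation obviously respects meets. It respects joins because it
  is also defined by the meet irreducibles of the same ropes: if \<open>R\<close> and \<open>S\<close> are
  separated by the join irreducible of a rope with minimal transitive support, then the meet
  irreducible of that rope separates them too.
\<close>

section \<open>Arc sets of skeletal graphs\<close>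

text \<open>What the lattice argument uses of a skeletal graph, stated on its arcs. Vertebracy
  appears here as \<open>mid_comparable\<close>: incomparable \<open>w\<close> and \<open>w'\<close>
  would give the 4-cycle \<open>u\<close>, \<open>w\<close>, \<open>v\<close>, \<open>w'\<close> in
  the transitive reduction of the subgraph that they induce.\<close>

locale skeletal_arcs =
  fixes A :: "('a \<times> 'a) set"
  assumes finite_arcs: "finite A"
    and acyclic_arcs: "acyclic A"
    and filled_arcs: "\<lbrakk>(u, v) \<in> A; (u, w) \<in> A\<^sup>+; (w, v) \<in> A\<^sup>+\<rbrakk> \<Longrightarrow> (u, w) \<in> A \<and> (w, v) \<in> A"
    and mid_comparable: "\<lbrakk>(u, v) \<in> A; (u, w) \<in> A; (w, v) \<in> A; (u, w') \<in> A; (w', v) \<in> A; w \<noteq> w'\<rbrakk>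
        \<Longrightarrow> (w, w') \<in> A \<or> (w', w) \<in> A"
begin

text \<open>For an arc \<open>(u, v)\<close>, the interior of its transitive support:
  \<open>filled_arcs\<close> shortens every path through \<open>w\<close> to two arcs.\<close>

definition mid :: "'a \<Rightarrow> 'a \<Rightarrow> 'a set" where
  "mid u v = {w. (u, w) \<in> A \<and> (w, v) \<in> A}"

text \<open>For skeletal graphs, the sets of reversed arcs of acyclic reorientations
  (lemma \<open>acyclic_reorient_iff\<close>).\<close>

definition biclosed :: "('a \<times> 'a) set \<Rightarrow> bool" where
  "biclosed R \<longleftrightarrow> R \<subseteq> A \<and>
     (\<forall>a c b. (a, c) \<in> A \<and> b \<in> mid a c \<longrightarrow>
        ((a, b) \<in> R \<and> (b, c) \<in> R \<longrightarrow> (a, c) \<in> R) \<and>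
        ((a, c) \<in> R \<longrightarrow> (a, b) \<in> R \<or> (b, c) \<in> R))"

definition is_rope :: "'a \<Rightarrow> 'a \<Rightarrow> 'a set \<Rightarrow> 'a set \<Rightarrow> bool" where
  "is_rope u v N T \<longleftrightarrow> (u, v) \<in> A \<and> N \<inter> T = {} \<and> N \<union> T = mid u v"

definition jirr :: "'a \<Rightarrow> 'a \<Rightarrow> 'a set \<Rightarrow> 'a set \<Rightarrow> ('a \<times> 'a) set" where
  "jirr u v N T = A \<inter> insert u N \<times> insert v T"

lemma irrefl_arcs: "(a, a) \<notin> A\<^sup>+"
  using acyclic_arcs by (auto simp: acyclic_def)

lemma not_loop: "(a, a) \<notin> A"
  using irrefl_arcs by blast

lemma asym_arcs: "(a, b) \<in> A \<Longrightarrow> (b, a) \<notin> A"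
  using irrefl_arcs[of a] by (meson r_into_trancl trancl_trans)

lemma no_3cycle: "(a, b) \<in> A \<Longrightarrow> (b, c) \<in> A \<Longrightarrow> (c, a) \<notin> A"
  using irrefl_arcs[of a] by (meson r_into_trancl trancl_trans)

lemma finite_mid: "finite (mid u v)"
proof -
  have "mid u v \<subseteq> snd ` A"
    by (force simp: mid_def)
  then show ?thesis
    using finite_arcs finite_subset by blast
qed

text \<open>With acyclicity, this makes the transitive support of an arc a chain.\<close>

lemma mid_total:
  assumes "(u, v) \<in> A" "x \<in> insert u (insert v (mid u v))" "y \<in> insert u (insert v (mid u v))" "x \<noteq> y"
  shows "(x, y) \<in> A \<or> (y, x) \<in> A"
  using assms mid_comparable[of u v x y] by (auto simp: mid_def)

lemma endpoints:
  assumes "(u, v) \<in> A" "(x, y) \<in> A" "x \<in> insert u (insert v (mid u v))" "y \<in> insert u (insert v (mid u v))"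
  shows "x \<in> insert u (mid u v)" "y \<in> insert v (mid u v)"
  using assms asym_arcs not_loop by (auto simp: mid_def)

lemma mid_subset:
  assumes "(u, v) \<in> A" "x \<in> insert u (mid u v)" "y \<in> insert v (mid u v)"
  shows "mid x y \<subseteq> mid u v"
proof
  fix w assume w: "w \<in> mid x y"
  have "(u, w) \<in> A\<^sup>+" "(w, v) \<in> A\<^sup>+"
    using assms w by (auto simp: mid_def intro: trancl_trans)
  then show "w \<in> mid u v"
    using filled_arcs[OF assms(1)] by (auto simp: mid_def)
qed

text \<open>The measure for \<open>separating_rope\<close> and \<open>mirr_imp_jirr\<close>. An
  endpoint moved inwards lies in \<open>mid u v\<close> but, as there are no loops, not in
  \<open>mid x y\<close>.\<close>

lemma card_mid_less:
  assumes "(u, v) \<in> A" "x \<in> insert u (mid u v)" "y \<in> insert v (mid u v)" "(x, y) \<noteq> (u, v)"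
  shows "card (mid x y) < card (mid u v)"
proof (rule psubset_card_mono[OF finite_mid])
  have "\<exists>z. z \<in> mid u v \<and> z \<notin> mid x y"
    using assms not_loop by (auto simp: mid_def)
  then show "mid x y \<subset> mid u v"
    using mid_subset[OF assms(1-3)] by blast
qed

lemma biclosedI:
  assumes "R \<subseteq> A"
    and "\<And>a b c. \<lbrakk>(a, c) \<in> A; b \<in> mid a c; (a, b) \<in> R; (b, c) \<in> R\<rbrakk> \<Longrightarrow> (a, c) \<in> R"
    and "\<And>a b c. \<lbrakk>(a, c) \<in> R; b \<in> mid a c\<rbrakk> \<Longrightarrow> (a, b) \<in> R \<or> (b, c) \<in> R"
  shows "biclosed R"
  using assms unfolding biclosed_def by blast

lemma biclosed_subset: "biclosed R \<Longrightarrow> R \<subseteq> A"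
  by (simp add: biclosed_def)

lemma biclosed_closed:
  "\<lbrakk>biclosed R; (a, c) \<in> A; (a, b) \<in> R; (b, c) \<in> R\<rbrakk> \<Longrightarrow> (a, c) \<in> R"
  unfolding biclosed_def mid_def by blast

lemma biclosed_coclosed:
  "\<lbrakk>biclosed R; (a, c) \<in> R; b \<in> mid a c\<rbrakk> \<Longrightarrow> (a, b) \<in> R \<or> (b, c) \<in> R"
  unfolding biclosed_def by blast

lemma biclosed_compl: "biclosed R \<Longrightarrow> biclosed (A - R)"
  unfolding biclosed_def mid_def by blast

section \<open>The lattice of biclosed sets\<close>

text \<open>Closedness is transitivity. For coclosedness, a path of arcs of \<open>R\<close> and
  \<open>S\<close> from \<open>a\<close> to \<open>c\<close> either visits \<open>b\<close> or jumps
  over it with one arc, and coclosedness of \<open>R\<close> or \<open>S\<close> splits that arc at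
  \<open>b\<close>.\<close>

lemma biclosed_closure:
  assumes R: "biclosed R" and S: "biclosed S"
  shows "biclosed (A \<inter> (R \<union> S)\<^sup>+)"
proof (rule biclosedI)
  let ?X = "R \<union> S"
  have XA: "?X \<subseteq> A"
    using R S biclosed_subset by blast
  then have XpA: "?X\<^sup>+ \<subseteq> A\<^sup>+"
    by (simp add: trancl_mono_subset)
  fix a b c assume ac: "(a, c) \<in> A \<inter> ?X\<^sup>+" and b: "b \<in> mid a c"
  have ab: "(a, b) \<in> A" and bc: "(b, c) \<in> A" and acA: "(a, c) \<in> A"
    using b ac by (auto simp: mid_def)
  have "(a, b) \<in> ?X\<^sup>+ \<or> (b, c) \<in> ?X\<^sup>+"
  proof (rule ccontr)
    assume contra: "\<not> ((a, b) \<in> ?X\<^sup>+ \<or> (b, c) \<in> ?X\<^sup>+)"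
    \<comment> \<open>Invariant along the path: if \<open>b\<close> is neither visited nor jumped
      over, every vertex stays before \<open>b\<close>. For \<open>x = c\<close> this contradicts
      the arc \<open>(b, c)\<close>.\<close>
    have "(x, c) \<in> ?X\<^sup>* \<Longrightarrow> (x, b) \<in> A" if "(a, x) \<in> ?X\<^sup>*" for x
      using that
    proof (induction x rule: rtrancl_induct)
      case base
      then show ?case using ab by simp
    next
      case (step x y)
      have xc: "(x, c) \<in> ?X\<^sup>*"
        using step by (meson converse_rtrancl_into_rtrancl)
      have xb: "(x, b) \<in> A"
        using step.IH[OF xc] .
      have ay: "(a, y) \<in> ?X\<^sup>+"
        using step by (meson rtrancl_into_trancl1)
      \<comment> \<open>Filledness keeps the path inside the support of \<open>(a, c)\<close>, so
        \<open>y\<close> is comparable with \<open>b\<close>.\<close>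
      have y: "y \<in> insert c (mid a c)"
      proof (cases "y = c")
        case False
        then have "(y, c) \<in> ?X\<^sup>+"
          using step.prems by (simp add: rtrancl_eq_or_trancl)
        then show ?thesis
          using filled_arcs[OF acA, of y] ay XpA by (auto simp: mid_def)
      qed simp
      have "y \<noteq> b"
        using ay contra by blast
      moreover have "(b, y) \<notin> A"
      proof
        assume "(b, y) \<in> A"
        then have "b \<in> mid x y"
          using xb by (simp add: mid_def)
        then have "(x, b) \<in> ?X \<or> (b, y) \<in> ?X"
          using step.hyps(2) biclosed_coclosed[OF R] biclosed_coclosed[OF S] by blast
        then show False
          using contra step.hyps(1) step.prems
          by (meson rtrancl_into_trancl1 rtrancl_into_trancl2)
      qed
      ultimately show ?case
        using mid_total[OF acA, of b y] b y by auto
    qed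
    from this[of c] have "(c, b) \<in> A"
      using ac by (simp add: trancl_into_rtrancl)
    then show False
      using bc asym_arcs by blast
  qed
  then show "(a, b) \<in> A \<inter> ?X\<^sup>+ \<or> (b, c) \<in> A \<inter> ?X\<^sup>+"
    using ab bc by blast
qed (auto intro: trancl_trans)

text \<open>Induction along the path: when \<open>(a, z)\<close> is an arc, filledness makes
  \<open>(a, y)\<close> an arc for the preceding vertex \<open>y\<close>, so closedness of
  \<open>Z\<close> absorbs one arc at a time.\<close>

lemma closure_least:
  assumes Z: "biclosed Z" and X: "X \<subseteq> Z"
  shows "A \<inter> X\<^sup>+ \<subseteq> Z"
proof -
  have XA: "X\<^sup>+ \<subseteq> A\<^sup>+"
    using X biclosed_subset[OF Z] by (meson subset_trans trancl_mono_subset)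
  have "(a, c) \<in> A \<longrightarrow> (a, c) \<in> Z" if "(a, c) \<in> X\<^sup>+" for a c
    using that
  proof (induction rule: trancl_induct)
    case (base y)
    then show ?case using X by blast
  next
    case (step y z)
    show ?case
    proof
      assume az: "(a, z) \<in> A"
      have "(a, y) \<in> A"
        using filled_arcs[OF az, of y] step.hyps XA by blast
      then show "(a, z) \<in> Z"
        using step X biclosed_closed[OF Z az] by blast
    qed
  qed
  then show ?thesis by auto
qed

definition AR :: "('a \<times> 'a) set gorder" where
  "AR = \<lparr> carrier = {R. biclosed R}, eq = (=), le = (\<subseteq>) \<rparr>"

lemma AR_simps [simp]:
  "R \<in> carrier AR \<longleftrightarrow> biclosed R" "R .=\<^bsub>AR\<^esub> S \<longleftrightarrow> R = S" "R \<sqsubseteq>\<^bsub>AR\<^esub> S \<longleftrightarrow> R \<subseteq> S"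
  by (simp_all add: AR_def)

lemma partial_order_AR: "partial_order AR"
  by unfold_locales (auto simp: AR_def)

lemma lattice_AR: "lattice AR"
proof -
  interpret partial_order AR by (rule partial_order_AR)
  show ?thesis
  proof unfold_locales
    fix R S assume "R \<in> carrier AR" "S \<in> carrier AR"
    then have R: "biclosed R" and S: "biclosed S" by simp_all
    let ?J = "A \<inter> (R \<union> S)\<^sup>+"
    have "least AR ?J (Upper AR {R, S})"
      unfolding least_def Upper_def
      using biclosed_closure[OF R S] closure_least[of _ "R \<union> S"] biclosed_subset[OF R] biclosed_subset[OF S] R S
      by auto
    then show "\<exists>s. least AR s (Upper AR {R, S})" by blast
    \<comment> \<open>Complementation in \<open>A\<close> reverses inclusion and preserves biclosed
      sets, so the meet is the complement of the join of the complements.\<close>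
    let ?M = "A - (A \<inter> ((A - R) \<union> (A - S))\<^sup>+)"
    have bM: "biclosed ?M"
      by (intro biclosed_compl biclosed_closure R S)
    have lower: "?M \<subseteq> R" "?M \<subseteq> S" by auto
    have "Z \<subseteq> ?M" if Z: "biclosed Z" "Z \<subseteq> R" "Z \<subseteq> S" for Z
      using closure_least[OF biclosed_compl[OF Z(1)], of "(A - R) \<union> (A - S)"] Z biclosed_subset[OF Z(1)]
      by auto
    then have "greatest AR ?M (Lower AR {R, S})"
      unfolding greatest_def Lower_def using bM lower R S by auto
    then show "\<exists>s. greatest AR s (Lower AR {R, S})" by blast
  qed
qed

sublocale AR: lattice AR
  by (rule lattice_AR)

lemma join_biclosed: "biclosed R \<Longrightarrow> biclosed S \<Longrightarrow> biclosed (R \<squnion>\<^bsub>AR\<^esub> S)"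
  using AR.join_closed by simp

lemma meet_biclosed: "biclosed R \<Longrightarrow> biclosed S \<Longrightarrow> biclosed (R \<sqinter>\<^bsub>AR\<^esub> S)"
  using AR.meet_closed by simp

lemma join_subset_iff:
  "\<lbrakk>biclosed R; biclosed S; biclosed Z\<rbrakk> \<Longrightarrow> R \<squnion>\<^bsub>AR\<^esub> S \<subseteq> Z \<longleftrightarrow> R \<subseteq> Z \<and> S \<subseteq> Z"
  using AR.join_le[of R Z S] AR.join_left[of R S] AR.join_right[of R S] by auto

lemma subset_meet_iff:
  "\<lbrakk>biclosed R; biclosed S; biclosed Z\<rbrakk> \<Longrightarrow> Z \<subseteq> R \<sqinter>\<^bsub>AR\<^esub> S \<longleftrightarrow> Z \<subseteq> R \<and> Z \<subseteq> S"
  using AR.meet_le[of Z R S] AR.meet_left[of R S] AR.meet_right[of R S] by auto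

lemma join_absorb: "biclosed R \<Longrightarrow> biclosed S \<Longrightarrow> R \<subseteq> S \<Longrightarrow> R \<squnion>\<^bsub>AR\<^esub> S = S"
  using join_subset_iff[of R S S] join_subset_iff[of R S "R \<squnion>\<^bsub>AR\<^esub> S"] join_biclosed by blast

lemma meet_absorb: "biclosed R \<Longrightarrow> biclosed S \<Longrightarrow> R \<subseteq> S \<Longrightarrow> R \<sqinter>\<^bsub>AR\<^esub> S = R"
  using subset_meet_iff[of R S R] subset_meet_iff[of R S "R \<sqinter>\<^bsub>AR\<^esub> S"] meet_biclosed by blast

section \<open>Join irreducibles of ropes\<close>

lemma is_rope_swap: "is_rope u v N T \<Longrightarrow> is_rope u v T N"
  by (auto simp: is_rope_def)

lemma rope_arc: "is_rope u v N T \<Longrightarrow> (u, v) \<in> A"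
  by (simp add: is_rope_def)

lemma rope_parts: "is_rope u v N T \<Longrightarrow> w \<in> N \<Longrightarrow> (u, w) \<in> A \<and> (w, v) \<in> A \<and> w \<notin> T \<and> w \<in> mid u v"
  "is_rope u v N T \<Longrightarrow> w \<in> T \<Longrightarrow> (u, w) \<in> A \<and> (w, v) \<in> A \<and> w \<notin> N \<and> w \<in> mid u v"
  by (auto simp: is_rope_def mid_def)

lemma rope_endpoints:
  assumes "is_rope u v N T"
  shows "u \<notin> N" "u \<notin> T" "v \<notin> N" "v \<notin> T" "u \<noteq> v"
  using rope_parts[OF assms, of u] rope_parts[OF assms, of v] rope_arc[OF assms] not_loop by auto

lemma rope_disjoint: "is_rope u v N T \<Longrightarrow> N \<inter> T = {}"
  by (simp add: is_rope_def)

lemma jirr_subset: "jirr u v N T \<subseteq> A"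
  by (simp add: jirr_def)

lemma arc_in_jirr: "(u, v) \<in> A \<Longrightarrow> (u, v) \<in> jirr u v N T"
  by (simp add: jirr_def)

text \<open>Relates the two irreducibles of a rope: the lower cover of \<open>jirr u v N T\<close>
  lies below the meet irreducible \<open>A - jirr u v T N\<close>, and only the arc
  \<open>(u, v)\<close> keeps \<open>jirr u v N T\<close> from doing so.\<close>

lemma jirr_swap:
  assumes "is_rope u v N T"
  shows "jirr u v N T \<inter> jirr u v T N = {(u, v)}"
  using rope_disjoint[OF assms] rope_endpoints[OF assms] rope_arc[OF assms] by (auto simp: jirr_def)

text \<open>The second half \<open>(b, c)\<close> works for \<open>b\<close> in \<open>N\<close>,
  the first half \<open>(a, b)\<close> for \<open>b\<close> in \<open>T\<close>. Neither is
  \<open>(u, v)\<close>, so the join irreducible and its lower cover are handled at once.\<close>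

lemma jirr_coclosed:
  assumes r: "is_rope u v N T" and ac: "(a, c) \<in> jirr u v N T" and b: "b \<in> mid a c"
  shows "(a, b) \<in> jirr u v N T - {(u, v)} \<or> (b, c) \<in> jirr u v N T - {(u, v)}"
proof -
  have "b \<in> mid u v"
    using mid_subset[of u v a c] r ac b by (auto simp: jirr_def is_rope_def)
  then have "b \<in> N \<or> b \<in> T"
    using r by (auto simp: is_rope_def)
  then show ?thesis
    using ac b rope_endpoints[OF r] by (auto simp: jirr_def mid_def)
qed

text \<open>Closedness is vacuous: heads lie in \<open>insert v T\<close>, tails in
  \<open>insert u N\<close>, and these sets are disjoint.\<close>

lemma jirr_closed:
  assumes r: "is_rope u v N T" and "(a, b) \<in> jirr u v N T"
  shows "(b, c) \<notin> jirr u v N T"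
  using assms(2) rope_endpoints[OF r] rope_parts(2)[OF r, of b] by (auto simp: jirr_def)

lemma biclosed_jirr:
  assumes "is_rope u v N T"
  shows "biclosed (jirr u v N T)"
  by (rule biclosedI[OF jirr_subset]) (use jirr_coclosed[OF assms] jirr_closed[OF assms] in blast)+

lemma biclosed_jirr_lower:
  assumes "is_rope u v N T"
  shows "biclosed (jirr u v N T - {(u, v)})"
proof (rule biclosedI)
  show "jirr u v N T - {(u, v)} \<subseteq> A" using jirr_subset by blast
qed (use jirr_coclosed[OF assms] jirr_closed[OF assms] in blast)+

text \<open>The arcs out of \<open>u\<close> decide: for \<open>p\<close> in \<open>N\<close>,
  coclosedness splits \<open>(u, q)\<close> at \<open>p\<close>, and since \<open>(u, p)\<close> is
  not in \<open>R\<close>, \<open>(p, q)\<close> must be.\<close>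

lemma jirr_subsetI:
  assumes r: "is_rope u v N T" and R: "biclosed R" and uv: "(u, v) \<in> R"
    and uN: "\<And>w. w \<in> N \<Longrightarrow> (u, w) \<notin> R"
    and uT: "\<And>w. w \<in> T \<Longrightarrow> (u, w) \<in> R"
  shows "jirr u v N T \<subseteq> R"
proof clarify
  fix p q assume pq: "(p, q) \<in> jirr u v N T"
  have uq: "(u, q) \<in> R"
    using pq uv uT by (auto simp: jirr_def)
  show "(p, q) \<in> R"
  proof (cases "p = u")
    case True
    then show ?thesis using uq by simp
  next
    case False
    then have "p \<in> N" using pq by (auto simp: jirr_def)
    then have "p \<in> mid u q"
      using pq rope_parts(1)[OF r] by (auto simp: mid_def jirr_def)
    then show ?thesis
      using biclosed_coclosed[OF R uq] uN[OF \<open>p \<in> N\<close>] by blast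
  qed
qed

text \<open>If \<open>R\<close> contains \<open>(u, v)\<close>, coclosedness forces the arcs from
  \<open>u\<close> to \<open>T\<close> into \<open>R\<close>, because the arcs from \<open>T\<close>
  to \<open>v\<close> are outside the join irreducible; then \<open>jirr_subsetI\<close>
  applies.\<close>

lemma jirr_irreducible:
  assumes r: "is_rope u v N T" and R: "biclosed R" and sub: "R \<subseteq> jirr u v N T" and ne: "R \<noteq> jirr u v N T"
  shows "R \<subseteq> jirr u v N T - {(u, v)}"
proof (rule ccontr)
  assume "\<not> ?thesis"
  then have uv: "(u, v) \<in> R" using sub by blast
  have uN: "(u, w) \<notin> R" if "w \<in> N" for w
    using that sub rope_endpoints[OF r] rope_parts(1)[OF r] by (auto simp: jirr_def)
  have "(w, v) \<notin> R" if "w \<in> T" for w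
    using that sub rope_endpoints[OF r] rope_parts(2)[OF r] by (auto simp: jirr_def)
  then have "(u, w) \<in> R" if "w \<in> T" for w
    using that biclosed_coclosed[OF R uv] rope_parts(2)[OF r] by blast
  then show False
    using jirr_subsetI[OF r R uv uN] sub ne by blast
qed

text \<open>Says that no other rope has its join irreducible below \<open>jirr u v N T\<close> but
  not below the lower cover; this recovers an ideal from its congruence. Acyclicity identifies the
  endpoints, and two nested partitions of the same set coincide.\<close>

lemma jirr_inject:
  assumes r: "is_rope u v N T" and r': "is_rope x y N' T'"
    and sub: "jirr x y N' T' \<subseteq> jirr u v N T" and uv: "(u, v) \<in> jirr x y N' T'"
  shows "x = u \<and> y = v \<and> N' = N \<and> T' = T"
proof -
  have "(x, y) \<in> jirr u v N T"
    using arc_in_jirr rope_arc[OF r'] sub by blast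
  then have x: "x \<in> insert u N" and y: "y \<in> insert v T" by (auto simp: jirr_def)
  have "u \<in> insert x N'" "v \<in> insert y T'" using uv by (auto simp: jirr_def)
  then have [simp]: "x = u" "y = v"
    using x y rope_parts(1)[OF r, of x] rope_parts(1)[OF r', of u]
      rope_parts(2)[OF r, of y] rope_parts(2)[OF r', of v] asym_arcs by auto
  have "N' \<subseteq> N"
  proof
    fix w assume w: "w \<in> N'"
    then have "(w, v) \<in> jirr x y N' T'"
      using rope_parts(1)[OF r'] by (auto simp: jirr_def)
    then have "(w, v) \<in> jirr u v N T" using sub by blast
    then show "w \<in> N"
      using w rope_endpoints[OF r'] by (auto simp: jirr_def)
  qed
  moreover have "T' \<subseteq> T"
  proof
    fix w assume w: "w \<in> T'"
    then have "(u, w) \<in> jirr x y N' T'"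
      using rope_parts(2)[OF r'] by (auto simp: jirr_def)
    then have "(u, w) \<in> jirr u v N T" using sub by blast
    then show "w \<in> T"
      using w rope_endpoints[OF r'] by (auto simp: jirr_def)
  qed
  moreover have "N' \<union> T' = N \<union> T" "N \<inter> T = {}"
    using r r' by (simp_all add: is_rope_def)
  ultimately show ?thesis by auto
qed

text \<open>Take an arc of \<open>R - S\<close> with smallest support and split its interior by
  whether \<open>(u, w)\<close> is in \<open>R\<close>. The other arcs of the join irreducible are
  in \<open>R\<close> and have smaller support, hence are in \<open>S\<close>.\<close>

lemma separating_rope:
  assumes R: "biclosed R" and S: "biclosed S" and RS: "\<not> R \<subseteq> S"
  obtains u v N T where "is_rope u v N T" "jirr u v N T \<subseteq> R" "(u, v) \<notin> S" "jirr u v N T - {(u, v)} \<subseteq> S"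
proof -
  have "\<exists>e. e \<in> R - S" using RS by blast
  then obtain e where e: "e \<in> R - S"
    and min: "\<And>e'. e' \<in> R - S \<Longrightarrow> card (mid (fst e) (snd e)) \<le> card (mid (fst e') (snd e'))"
    using ex_has_least_nat[of "\<lambda>e. e \<in> R - S" _ "\<lambda>e. card (mid (fst e) (snd e))"] by blast
  obtain u v where [simp]: "e = (u, v)" by (cases e)
  have uv: "(u, v) \<in> A" "(u, v) \<in> R" "(u, v) \<notin> S"
    using e biclosed_subset[OF R] by auto
  have small: "(x, y) \<in> S"
    if "(x, y) \<in> R" "x \<in> insert u (mid u v)" "y \<in> insert v (mid u v)" "(x, y) \<noteq> (u, v)" for x y
    using min[of "(x, y)"] card_mid_less[OF uv(1) that(2-4)] that(1) by fastforce
  define N where "N = {w \<in> mid u v. (u, w) \<notin> R}"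
  define T where "T = {w \<in> mid u v. (u, w) \<in> R}"
  have r: "is_rope u v N T"
    using uv by (auto simp: is_rope_def N_def T_def)
  have sub: "jirr u v N T \<subseteq> R"
    by (rule jirr_subsetI[OF r R uv(2)]) (auto simp: N_def T_def)
  moreover have "jirr u v N T - {(u, v)} \<subseteq> S"
  proof clarify
    fix x y assume xy: "(x, y) \<in> jirr u v N T" "(x, y) \<notin> S"
    show "x = u \<and> y = v"
      using small[of x y] xy sub by (auto simp: jirr_def N_def T_def)
  qed
  ultimately show ?thesis using that r uv by blast
qed

section \<open>Subropes\<close>

lemma restrict_rope:
  assumes r: "is_rope u v N T" and xy: "(x, y) \<in> A" "x \<in> insert u (mid u v)" "y \<in> insert v (mid u v)"
  shows "is_rope x y (N \<inter> mid x y) (T \<inter> mid x y)"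
  using mid_subset[OF rope_arc[OF r] xy(2,3)] r xy(1) by (auto simp: is_rope_def)

text \<open>A subrope is determined by its arc: its two parts cover \<open>mid x y\<close> and lie
  in the disjoint sets \<open>N\<close> and \<open>T\<close>.\<close>

lemma subrope_restrict:
  assumes r: "is_rope u v N T" and r': "is_rope x y N' T'" and sub: "subrope (x, y, N', T') (u, v, N, T)"
  shows "x \<in> insert u (mid u v)" "y \<in> insert v (mid u v)" "N' = N \<inter> mid x y" "T' = T \<inter> mid x y"
proof -
  have eqs: "N \<union> T = mid u v" "N' \<union> T' = mid x y" "N \<inter> T = {}"
    using r r' by (simp_all add: is_rope_def)
  have s: "{x, y} \<subseteq> insert u (insert v (mid u v))" "N' \<subseteq> N" "T' \<subseteq> T"
    using sub unfolding subrope_def eqs(1)[symmetric] by auto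
  then show "x \<in> insert u (mid u v)" "y \<in> insert v (mid u v)"
    using endpoints[OF rope_arc[OF r] rope_arc[OF r']] by auto
  show "N' = N \<inter> mid x y" "T' = T \<inter> mid x y"
    using s(2,3) eqs unfolding eqs(2)[symmetric] by blast+
qed

lemma restrict_subrope:
  assumes r: "is_rope u v N T" and xy: "x \<in> insert u (mid u v)" "y \<in> insert v (mid u v)"
  shows "subrope (x, y, N \<inter> mid x y, T \<inter> mid x y) (u, v, N, T)"
  using assms by (auto simp: subrope_def is_rope_def)

text \<open>Together with \<open>ideals\<close>, the versions of \<open>ropes\<close> and
  \<open>rope_lower_ideals\<close> that use \<open>mid\<close> for the interior of the transitive
  support; the final proof identifies them.\<close>

definition all_ropes :: "'a rope set" where
  "all_ropes = {(u, v, N, T). is_rope u v N T}"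

definition ideals :: "'a rope set set" where
  "ideals = {I. I \<subseteq> all_ropes \<and> (\<forall>\<rho>' \<in> I. \<forall>\<rho> \<in> all_ropes. subrope \<rho> \<rho>' \<longrightarrow> \<rho> \<in> I)}"

lemma idealsI:
  assumes "\<And>u v N T. (u, v, N, T) \<in> I \<Longrightarrow> is_rope u v N T"
    and "\<And>u v N T x y N' T'. \<lbrakk>(u, v, N, T) \<in> I; is_rope x y N' T'; subrope (x, y, N', T') (u, v, N, T)\<rbrakk>
      \<Longrightarrow> (x, y, N', T') \<in> I"
  shows "I \<in> ideals"
proof -
  have "\<rho> \<in> I" if "\<rho>' \<in> I" "\<rho> \<in> all_ropes" "subrope \<rho> \<rho>'" for \<rho> \<rho>'
  proof -
    obtain u v N T x y N' T' where [simp]: "\<rho>' = (u, v, N, T)" "\<rho> = (x, y, N', T')"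
      using prod_cases4 by metis
    show ?thesis
      using assms(2)[of u v N T x y N' T'] that by (simp add: all_ropes_def)
  qed
  moreover have "I \<subseteq> all_ropes"
    using assms(1) by (auto simp: all_ropes_def)
  ultimately show ?thesis
    unfolding ideals_def by blast
qed

lemma ideal_rope: "I \<in> ideals \<Longrightarrow> (u, v, N, T) \<in> I \<Longrightarrow> is_rope u v N T"
  by (auto simp: ideals_def all_ropes_def)

lemma ideal_restrict:
  assumes "I \<in> ideals" "(u, v, N, T) \<in> I" "(x, y) \<in> A" "x \<in> insert u (mid u v)" "y \<in> insert v (mid u v)"
  shows "(x, y, N \<inter> mid x y, T \<inter> mid x y) \<in> I"
proof -
  have r: "is_rope u v N T" using assms ideal_rope by blast
  show ?thesis
    using assms restrict_rope[OF r assms(3-5)] restrict_subrope[OF r assms(4,5)]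
    unfolding ideals_def all_ropes_def by blast
qed

text \<open>The duality on ropes that goes with complementation of biclosed sets: it exchanges join
  and meet irreducibles.\<close>

definition swap :: "'a rope \<Rightarrow> 'a rope" where
  "swap = (\<lambda>(u, v, N, T). (u, v, T, N))"

lemma swap_in_iff: "(u, v, N, T) \<in> swap ` I \<longleftrightarrow> (u, v, T, N) \<in> I"
  by (force simp: swap_def)

lemma swap_ideal:
  assumes I: "I \<in> ideals"
  shows "swap ` I \<in> ideals"
proof (rule idealsI)
  show "is_rope u v N T" if "(u, v, N, T) \<in> swap ` I" for u v N T
    using that ideal_rope[OF I] is_rope_swap unfolding swap_in_iff by blast
  show "(x, y, N', T') \<in> swap ` I"
    if "(u, v, N, T) \<in> swap ` I" "is_rope x y N' T'" "subrope (x, y, N', T') (u, v, N, T)"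
    for u v N T x y N' T'
  proof -
    have "subrope (x, y, T', N') (u, v, T, N)"
      using that(3) by (auto simp: subrope_def)
    moreover have "(x, y, T', N') \<in> all_ropes"
      using is_rope_swap that(2) by (simp add: all_ropes_def)
    ultimately show ?thesis
      using I that(1) unfolding swap_in_iff ideals_def by blast
  qed
qed

section \<open>The congruence of an ideal\<close>

definition cong :: "'a rope set \<Rightarrow> (('a \<times> 'a) set \<times> ('a \<times> 'a) set) set" where
  "cong I = {(R, S). biclosed R \<and> biclosed S \<and>
     (\<forall>(u, v, N, T) \<in> I. jirr u v N T \<subseteq> R \<longleftrightarrow> jirr u v N T \<subseteq> S)}"

lemma congI:
  assumes "biclosed R" "biclosed S"
    and "\<And>u v N T. (u, v, N, T) \<in> I \<Longrightarrow> jirr u v N T \<subseteq> R \<longleftrightarrow> jirr u v N T \<subseteq> S"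
  shows "(R, S) \<in> cong I"
  using assms(1,2) by (clarsimp simp: cong_def assms(3))

lemma cong_biclosed: "(R, S) \<in> cong I \<Longrightarrow> biclosed R \<and> biclosed S"
  by (simp add: cong_def)

lemma congD:
  "(R, S) \<in> cong I \<Longrightarrow> (u, v, N, T) \<in> I \<Longrightarrow> jirr u v N T \<subseteq> R \<longleftrightarrow> jirr u v N T \<subseteq> S"
  by (auto simp: cong_def)

text \<open>\<open>A - jirr u v T N\<close> is the meet irreducible of the rope \<open>(u, v, N, T)\<close>: the
  join and the meet irreducibles of an ideal define the same congruence.\<close>

lemma mirr_imp_jirr:
  assumes I: "I \<in> ideals" and R: "biclosed R" and S: "biclosed S"
    and same: "\<And>u v N T. (u, v, N, T) \<in> I \<Longrightarrow> jirr u v T N \<inter> S = {} \<Longrightarrow> jirr u v T N \<inter> R = {}"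
    and "(u, v, N, T) \<in> I" "jirr u v N T \<subseteq> R"
  shows "jirr u v N T \<subseteq> S"
  using assms(5,6)
proof (induction "card (mid u v)" arbitrary: u v N T rule: less_induct)
  case less
  have r: "is_rope u v N T" using ideal_rope[OF I less.prems(1)] .
  note uv = rope_arc[OF r]
  \<comment> \<open>Every other arc of the join irreducible spans a restriction of the rope, which
    belongs to \<open>I\<close> and has smaller support, so the induction hypothesis
    applies.\<close>
  have rest: "(x, y) \<in> S" if xy: "(x, y) \<in> jirr u v N T" "(x, y) \<noteq> (u, v)" for x y
  proof -
    have x: "x \<in> insert u N" and y: "y \<in> insert v T" and xyA: "(x, y) \<in> A"
      using xy by (auto simp: jirr_def)
    have x': "x \<in> insert u (mid u v)" and y': "y \<in> insert v (mid u v)"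
      using x y r by (auto simp: is_rope_def)
    let ?J = "jirr x y (N \<inter> mid x y) (T \<inter> mid x y)"
    have "?J \<subseteq> jirr u v N T"
      using x y by (auto simp: jirr_def)
    then have "?J \<subseteq> S"
      using less.hyps[OF card_mid_less[OF uv x' y' xy(2)] ideal_restrict[OF I less.prems(1) xyA x' y']]
        less.prems(2) by (meson subset_trans)
    then show ?thesis
      using arc_in_jirr[OF xyA] by blast
  qed
  \<comment> \<open>Without \<open>(u, v)\<close>, closedness of \<open>S\<close> together with
    \<open>rest\<close> would keep \<open>S\<close> disjoint from \<open>jirr u v T N\<close>; by
    \<open>same\<close> so would be \<open>R\<close>, which contains \<open>(u, v)\<close>.\<close>
  have "(u, v) \<in> S"
  proof (rule ccontr)
    assume uvS: "(u, v) \<notin> S"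
    have uN: "(u, n) \<notin> S" if n: "n \<in> N" for n
    proof -
      have "(n, v) \<in> S"
        using rest[of n v] n rope_parts(1)[OF r n] rope_endpoints[OF r] by (auto simp: jirr_def)
      then show ?thesis using biclosed_closed[OF S uv] uvS by blast
    qed
    have uT: "(u, t) \<in> S" if t: "t \<in> T" for t
      using rest[of u t] t rope_parts(2)[OF r t] rope_endpoints[OF r] by (auto simp: jirr_def)
    have Tv: "(t, v) \<notin> S" if t: "t \<in> T" for t
      using uT[OF t] biclosed_closed[OF S uv] uvS by blast
    have "(t, n) \<notin> S" if t: "t \<in> T" and n: "n \<in> N" for t n
      using uT[OF t] uN[OF n] rope_parts(1)[OF r n] biclosed_closed[OF S, of u n t] by blast
    then have "(p, q) \<notin> S" if "(p, q) \<in> jirr u v T N" for p q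
      using that uN Tv uvS unfolding jirr_def by blast
    then have "jirr u v T N \<inter> S = {}" by auto
    then have "jirr u v T N \<inter> R = {}"
      using same less.prems(1) by blast
    then show False
      using less.prems(2) arc_in_jirr[OF uv] by blast
  qed
  then show ?case using rest by auto
qed

text \<open>The converse passage, by duality: \<open>mirr_imp_jirr\<close> for the complements of
  \<open>R\<close> and \<open>S\<close> and the swapped ideal.\<close>

lemma cong_mirr:
  assumes I: "I \<in> ideals" and RS: "(R, S) \<in> cong I" and \<rho>: "(u, v, N, T) \<in> I"
    and "jirr u v T N \<inter> R = {}"
  shows "jirr u v T N \<inter> S = {}"
proof -
  have b: "biclosed R" "biclosed S" using RS by (auto simp: cong_def)
  have "jirr u v T N \<subseteq> A - S"
  proof (rule mirr_imp_jirr[OF swap_ideal[OF I] biclosed_compl[OF b(1)] biclosed_compl[OF b(2)]])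
    fix x y N' T'
    assume "(x, y, N', T') \<in> swap ` I" "jirr x y T' N' \<inter> (A - S) = {}"
    then have "jirr x y T' N' \<subseteq> S" "(x, y, T', N') \<in> I"
      using jirr_subset[of x y T' N'] by (auto simp: swap_in_iff)
    then show "jirr x y T' N' \<inter> (A - R) = {}"
      using congD[OF RS] by blast
  next
    show "(u, v, T, N) \<in> swap ` I" using \<rho> by (simp add: swap_in_iff)
    show "jirr u v T N \<subseteq> A - R" using assms(4) jirr_subset[of u v T N] by blast
  qed
  then show ?thesis by blast
qed

lemma cong_sym: "(R, S) \<in> cong I \<Longrightarrow> (S, R) \<in> cong I"
  by (auto simp: cong_def)

lemma cong_trans: "(R, S) \<in> cong I \<Longrightarrow> (S, Z) \<in> cong I \<Longrightarrow> (R, Z) \<in> cong I"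
  by (rule congI) (simp_all add: cong_biclosed congD)

lemma equiv_cong: "equiv (carrier AR) (cong I)"
proof (rule equivI)
  show "cong I \<subseteq> carrier AR \<times> carrier AR" by (auto simp: cong_def)
  show "refl_on (carrier AR) (cong I)" by (auto simp: cong_def refl_on_def)
  show "sym (cong I)" by (auto intro: symI cong_sym)
  show "trans (cong I)" by (auto intro: transI cong_trans)
qed

lemma cong_meet:
  assumes I: "I \<in> ideals" and RR: "(R, R') \<in> cong I" and SS: "(S, S') \<in> cong I"
  shows "(R \<sqinter>\<^bsub>AR\<^esub> S, R' \<sqinter>\<^bsub>AR\<^esub> S') \<in> cong I"
proof -
  have b: "biclosed R" "biclosed S" "biclosed R'" "biclosed S'"
    using RR SS by (auto simp: cong_def)
  have "jirr u v N T \<subseteq> R \<sqinter>\<^bsub>AR\<^esub> S \<longleftrightarrow> jirr u v N T \<subseteq> R' \<sqinter>\<^bsub>AR\<^esub> S'" if \<rho>: "(u, v, N, T) \<in> I" for u v N T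
    using congD[OF RR \<rho>] congD[OF SS \<rho>] biclosed_jirr[OF ideal_rope[OF I \<rho>]]
      subset_meet_iff[OF b(1,2)] subset_meet_iff[OF b(3,4)] by simp
  then show ?thesis
    by (intro congI meet_biclosed b)
qed

lemma join_disjoint_jirr_iff:
  assumes "is_rope u v N T" "biclosed R" "biclosed S"
  shows "jirr u v N T \<inter> (R \<squnion>\<^bsub>AR\<^esub> S) = {} \<longleftrightarrow> jirr u v N T \<inter> R = {} \<and> jirr u v N T \<inter> S = {}"
proof -
  have "jirr u v N T \<inter> Z = {} \<longleftrightarrow> Z \<subseteq> A - jirr u v N T" if "biclosed Z" for Z
    using biclosed_subset[OF that] by blast
  then show ?thesis
    using join_subset_iff[OF assms(2,3) biclosed_compl[OF biclosed_jirr[OF assms(1)]]]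
      join_biclosed[OF assms(2,3)] assms(2,3) by simp
qed

text \<open>Being below a meet irreducible passes to joins, as being above a join irreducible passes
  to meets. So pass to meet irreducibles with \<open>cong_mirr\<close> and return with
  \<open>mirr_imp_jirr\<close>.\<close>

lemma cong_join:
  assumes I: "I \<in> ideals" and RR: "(R, R') \<in> cong I" and SS: "(S, S') \<in> cong I"
  shows "(R \<squnion>\<^bsub>AR\<^esub> S, R' \<squnion>\<^bsub>AR\<^esub> S') \<in> cong I"
proof -
  have b: "biclosed R" "biclosed S" "biclosed R'" "biclosed S'"
    using RR SS by (auto simp: cong_def)
  have *: "jirr u v T N \<inter> (R \<squnion>\<^bsub>AR\<^esub> S) = {} \<longleftrightarrow> jirr u v T N \<inter> (R' \<squnion>\<^bsub>AR\<^esub> S') = {}"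
    if \<rho>: "(u, v, N, T) \<in> I" for u v N T
    using join_disjoint_jirr_iff[OF is_rope_swap[OF ideal_rope[OF I \<rho>]] b(1,2)]
      join_disjoint_jirr_iff[OF is_rope_swap[OF ideal_rope[OF I \<rho>]] b(3,4)]
      cong_mirr[OF I RR \<rho>] cong_mirr[OF I SS \<rho>] cong_mirr[OF I cong_sym[OF RR] \<rho>] cong_mirr[OF I cong_sym[OF SS] \<rho>]
    by metis
  have "jirr u v N T \<subseteq> R \<squnion>\<^bsub>AR\<^esub> S \<longleftrightarrow> jirr u v N T \<subseteq> R' \<squnion>\<^bsub>AR\<^esub> S'" if \<rho>: "(u, v, N, T) \<in> I" for u v N T
  proof
    show "jirr u v N T \<subseteq> R' \<squnion>\<^bsub>AR\<^esub> S'" if "jirr u v N T \<subseteq> R \<squnion>\<^bsub>AR\<^esub> S"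
      using mirr_imp_jirr[OF I join_biclosed[OF b(1,2)] join_biclosed[OF b(3,4)] _ \<rho> that] * by blast
    show "jirr u v N T \<subseteq> R \<squnion>\<^bsub>AR\<^esub> S" if "jirr u v N T \<subseteq> R' \<squnion>\<^bsub>AR\<^esub> S'"
      using mirr_imp_jirr[OF I join_biclosed[OF b(3,4)] join_biclosed[OF b(1,2)] _ \<rho> that] * by blast
  qed
  then show ?thesis
    by (intro congI join_biclosed b)
qed

lemma congruence_cong: "I \<in> ideals \<Longrightarrow> lattice_congruence AR (cong I)"
  unfolding lattice_congruence_def by (simp add: lattice_AR equiv_cong cong_meet cong_join)

section \<open>The ideal of a congruence\<close>

definition uncontracted :: "(('a \<times> 'a) set \<times> ('a \<times> 'a) set) set \<Rightarrow> 'a rope set" where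
  "uncontracted \<theta> = {(u, v, N, T). is_rope u v N T \<and> (jirr u v N T, jirr u v N T - {(u, v)}) \<notin> \<theta>}"

context
  fixes \<theta> assumes \<theta>: "lattice_congruence AR \<theta>"
begin

lemma theta_biclosed: "(R, S) \<in> \<theta> \<Longrightarrow> biclosed R \<and> biclosed S"
  using \<theta> by (auto simp: lattice_congruence_def equiv_def)

lemma theta_refl: "biclosed R \<Longrightarrow> (R, R) \<in> \<theta>"
  using \<theta> by (auto simp: lattice_congruence_def equiv_def refl_on_def)

lemma theta_sym: "(R, S) \<in> \<theta> \<Longrightarrow> (S, R) \<in> \<theta>"
  using \<theta> by (auto simp: lattice_congruence_def equiv_def dest: symD)

lemma theta_trans: "(R, S) \<in> \<theta> \<Longrightarrow> (S, Z) \<in> \<theta> \<Longrightarrow> (R, Z) \<in> \<theta>"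
  using \<theta> by (auto simp: lattice_congruence_def equiv_def dest: transD)

lemma theta_join: "(R, S) \<in> \<theta> \<Longrightarrow> biclosed Z \<Longrightarrow> (R \<squnion>\<^bsub>AR\<^esub> Z, S \<squnion>\<^bsub>AR\<^esub> Z) \<in> \<theta>"
  using \<theta> theta_refl unfolding lattice_congruence_def by blast

lemma theta_meet: "(R, S) \<in> \<theta> \<Longrightarrow> biclosed Z \<Longrightarrow> (R \<sqinter>\<^bsub>AR\<^esub> Z, S \<sqinter>\<^bsub>AR\<^esub> Z) \<in> \<theta>"
  using \<theta> theta_refl unfolding lattice_congruence_def by blast

text \<open>Meeting the pair with the join irreducible \<open>?J\<close> identifies
  \<open>?J\<close> with an element strictly below it, hence below \<open>?J'\<close>; joining with
  \<open>?J'\<close> then identifies \<open>?J\<close> with \<open>?J'\<close>.\<close>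

lemma contracted_jirr:
  assumes r: "is_rope u v N T" and RS: "(R, S) \<in> \<theta>" and "jirr u v N T \<subseteq> R" "\<not> jirr u v N T \<subseteq> S"
  shows "(jirr u v N T, jirr u v N T - {(u, v)}) \<in> \<theta>"
proof -
  let ?J = "jirr u v N T" and ?J' = "jirr u v N T - {(u, v)}"
  have b: "biclosed R" "biclosed S" "biclosed ?J" "biclosed ?J'"
    using theta_biclosed[OF RS] biclosed_jirr[OF r] biclosed_jirr_lower[OF r] by auto
  have "(?J \<sqinter>\<^bsub>AR\<^esub> R, ?J \<sqinter>\<^bsub>AR\<^esub> S) \<in> \<theta>"
    using theta_meet[OF RS b(3)] meet_comm[of AR] by simp
  then have *: "(?J, ?J \<sqinter>\<^bsub>AR\<^esub> S) \<in> \<theta>"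
    using meet_absorb b assms(3) by simp
  have bM: "biclosed (?J \<sqinter>\<^bsub>AR\<^esub> S)" using meet_biclosed b by blast
  have sub: "?J \<sqinter>\<^bsub>AR\<^esub> S \<subseteq> ?J" "?J \<sqinter>\<^bsub>AR\<^esub> S \<subseteq> S"
    using AR.meet_left[of ?J S] AR.meet_right[of ?J S] b by auto
  then have "?J \<sqinter>\<^bsub>AR\<^esub> S \<subseteq> ?J'"
    using jirr_irreducible[OF r bM] assms(4) by blast
  moreover have "(?J \<squnion>\<^bsub>AR\<^esub> ?J', (?J \<sqinter>\<^bsub>AR\<^esub> S) \<squnion>\<^bsub>AR\<^esub> ?J') \<in> \<theta>"
    using theta_join[OF * b(4)] .
  moreover have "?J \<squnion>\<^bsub>AR\<^esub> ?J' = ?J"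
    using join_absorb[OF b(4) b(3)] join_comm[of AR ?J ?J'] by auto
  ultimately show ?thesis
    using join_absorb[OF bM b(4)] by simp
qed

text \<open>With \<open>\<sigma>\<close> the restriction of the rope to \<open>(x, y)\<close>, the join irreducible of \<open>\<sigma>\<close> crosses
  the meet irreducible of the rope here, and dually in the next lemma.\<close>

lemma contracted_extend_up:
  assumes r: "is_rope u v N T" and xy: "(x, y) \<in> A" "x \<in> insert u T" "y \<in> insert v N"
    and con: "(jirr x y (N \<inter> mid x y) (T \<inter> mid x y), jirr x y (N \<inter> mid x y) (T \<inter> mid x y) - {(x, y)}) \<in> \<theta>"
  shows "(jirr u v N T, jirr u v N T - {(u, v)}) \<in> \<theta>"
proof -
  let ?J = "jirr x y (N \<inter> mid x y) (T \<inter> mid x y)"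
  let ?J' = "?J - {(x, y)}"
  let ?M = "A - jirr u v T N"
  note uv = rope_arc[OF r] and re = rope_endpoints[OF r]
  have b: "biclosed ?J" "biclosed ?J'" "biclosed ?M"
    using theta_biclosed[OF con] biclosed_compl[OF biclosed_jirr[OF is_rope_swap[OF r]]] by auto
  \<comment> \<open>Hence \<open>(x, y)\<close> is the only arc of \<open>?J\<close> that can lie in
    \<open>jirr u v T N\<close>.\<close>
  have "u \<notin> mid x y" "v \<notin> mid x y"
    using xy(2,3) rope_parts(2)[OF r, of x] rope_parts(1)[OF r, of y] not_loop asym_arcs
    by (auto simp: mid_def)
  then have "?J' \<subseteq> ?M"
    using rope_disjoint[OF r] by (auto simp: jirr_def)
  then have "(?J \<squnion>\<^bsub>AR\<^esub> ?M, ?M) \<in> \<theta>"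
    using theta_join[OF con b(3)] join_absorb[OF b(2,3)] by simp
  moreover have "jirr u v N T \<subseteq> ?J \<squnion>\<^bsub>AR\<^esub> ?M"
  proof -
    let ?Z = "?J \<squnion>\<^bsub>AR\<^esub> ?M"
    have Z: "biclosed ?Z" using join_biclosed b by blast
    have JZ: "?J \<subseteq> ?Z" and MZ: "?M \<subseteq> ?Z"
      using AR.join_left[of ?J ?M] AR.join_right[of ?J ?M] b by auto
    have xyZ: "(x, y) \<in> ?Z" using JZ arc_in_jirr[OF xy(1)] by blast
    \<comment> \<open>The join contains the path \<open>u\<close>, \<open>x\<close>,
      \<open>y\<close>, \<open>v\<close>, with coinciding vertices dropped: its outer arcs are in
      \<open>?M\<close>, its middle arc in \<open>?J\<close>. Closedness yields
      \<open>(x, v)\<close>, then \<open>(u, v)\<close>.\<close>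
    have xv: "(x, v) \<in> ?Z"
    proof (cases "y = v")
      case False
      then have "(y, v) \<in> ?M"
        using xy(3) rope_parts(1)[OF r] re by (auto simp: jirr_def)
      moreover have "(x, v) \<in> A" using xy(2) uv rope_parts(2)[OF r] by auto
      ultimately show ?thesis
        using biclosed_closed[OF Z _ xyZ] MZ by blast
    qed (use xyZ in simp)
    have uvZ: "(u, v) \<in> ?Z"
    proof (cases "x = u")
      case False
      then have "(u, x) \<in> ?M"
        using xy(2) rope_parts(2)[OF r] re by (auto simp: jirr_def)
      then show ?thesis
        using biclosed_closed[OF Z uv _ xv] MZ by blast
    qed (use xv in simp)
    have "jirr u v N T - {(u, v)} \<subseteq> ?M"
      using jirr_swap[OF r] jirr_subset[of u v N T] by blast
    then show ?thesis using uvZ MZ by blast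
  qed
  moreover have "\<not> jirr u v N T \<subseteq> ?M"
    using arc_in_jirr[OF uv] by blast
  ultimately show ?thesis
    using contracted_jirr[OF r] by blast
qed

lemma contracted_extend_down:
  assumes r: "is_rope u v N T" and xy: "(x, y) \<in> A" "x \<in> insert u N" "y \<in> insert v T"
    and con: "(jirr x y (N \<inter> mid x y) (T \<inter> mid x y), jirr x y (N \<inter> mid x y) (T \<inter> mid x y) - {(x, y)}) \<in> \<theta>"
  shows "(jirr u v N T, jirr u v N T - {(u, v)}) \<in> \<theta>"
proof -
  let ?J = "jirr x y (N \<inter> mid x y) (T \<inter> mid x y)"
  let ?J' = "?J - {(x, y)}"
  \<comment> \<open>Now the meet irreducible of the restriction: \<open>(x, y)\<close> is the only
    arc of \<open>jirr u v N T\<close> outside \<open>?M\<close>, and joining with \<open>?J\<close>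
    supplies it.\<close>
  let ?M = "A - jirr x y (T \<inter> mid x y) (N \<inter> mid x y)"
  note uv = rope_arc[OF r] and re = rope_endpoints[OF r]
  have x': "x \<in> insert u (mid u v)" and y': "y \<in> insert v (mid u v)"
    using xy r by (auto simp: is_rope_def)
  note r' = restrict_rope[OF r xy(1) x' y']
  have b: "biclosed ?J" "biclosed ?J'" "biclosed ?M"
    using theta_biclosed[OF con] biclosed_compl[OF biclosed_jirr[OF is_rope_swap[OF r']]] by auto
  have "?J' \<subseteq> ?M"
    using jirr_swap[OF r'] jirr_subset[of x y "N \<inter> mid x y" "T \<inter> mid x y"] by blast
  then have "(?J \<squnion>\<^bsub>AR\<^esub> ?M, ?M) \<in> \<theta>"
    using theta_join[OF con b(3)] join_absorb[OF b(2,3)] by simp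
  moreover have "jirr u v N T \<subseteq> ?J \<squnion>\<^bsub>AR\<^esub> ?M"
  proof -
    have "jirr u v N T - {(x, y)} \<subseteq> ?M"
      using re rope_disjoint[OF r] by (auto simp: jirr_def)
    moreover have "?J \<subseteq> ?J \<squnion>\<^bsub>AR\<^esub> ?M" "?M \<subseteq> ?J \<squnion>\<^bsub>AR\<^esub> ?M"
      using AR.join_left[of ?J ?M] AR.join_right[of ?J ?M] b by auto
    ultimately show ?thesis
      using arc_in_jirr[OF xy(1), of "N \<inter> mid x y" "T \<inter> mid x y"] by blast
  qed
  moreover have "\<not> jirr u v N T \<subseteq> ?M"
    using arc_in_jirr[OF xy(1)] xy by (auto simp: jirr_def)
  ultimately show ?thesis
    using contracted_jirr[OF r] by blast
qed

text \<open>If \<open>x\<close> and \<open>y\<close> are both in \<open>N\<close> or both in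
  \<open>T\<close>, neither previous lemma applies directly. Moving one endpoint at a time, through
  \<open>(x, v)\<close>, leaves one of them applicable at each step.\<close>

lemma contracted_extend:
  assumes r: "is_rope u v N T" and xy: "(x, y) \<in> A" "x \<in> insert u (mid u v)" "y \<in> insert v (mid u v)"
    and con: "(jirr x y (N \<inter> mid x y) (T \<inter> mid x y), jirr x y (N \<inter> mid x y) (T \<inter> mid x y) - {(x, y)}) \<in> \<theta>"
  shows "(jirr u v N T, jirr u v N T - {(u, v)}) \<in> \<theta>"
proof -
  let ?N = "N \<inter> mid x v" and ?T = "T \<inter> mid x v"
  have xv: "(x, v) \<in> A" using xy(2) rope_arc[OF r] by (auto simp: mid_def)
  have v: "v \<in> insert v (mid u v)" by simp
  note r' = restrict_rope[OF r xv xy(2) v]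
  have y: "y = v \<or> y \<in> ?N \<or> y \<in> ?T"
    using xy r by (auto simp: is_rope_def mid_def)
  have "mid x y \<subseteq> mid x v"
    using mid_subset[OF xv, of x y] y by auto
  then have eq: "?N \<inter> mid x y = N \<inter> mid x y" "?T \<inter> mid x y = T \<inter> mid x y" by auto
  have "(jirr x v ?N ?T, jirr x v ?N ?T - {(x, v)}) \<in> \<theta>"
    using y contracted_extend_up[OF r' xy(1)] contracted_extend_down[OF r' xy(1)] con unfolding eq by blast
  moreover have "x \<in> insert u N \<or> x \<in> insert u T"
    using xy(2) r by (auto simp: is_rope_def)
  ultimately show ?thesis
    using contracted_extend_up[OF r xv] contracted_extend_down[OF r xv] by blast
qed

lemma uncontracted_ideal: "uncontracted \<theta> \<in> ideals"
proof (rule idealsI)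
  show "is_rope u v N T" if "(u, v, N, T) \<in> uncontracted \<theta>" for u v N T
    using that by (simp add: uncontracted_def)
  show "(x, y, N', T') \<in> uncontracted \<theta>"
    if "(u, v, N, T) \<in> uncontracted \<theta>" and r': "is_rope x y N' T'" and s: "subrope (x, y, N', T') (u, v, N, T)"
    for u v N T x y N' T'
  proof -
    have r: "is_rope u v N T" and un: "(jirr u v N T, jirr u v N T - {(u, v)}) \<notin> \<theta>"
      using that(1) by (auto simp: uncontracted_def)
    note sr = subrope_restrict[OF r r' s]
    show ?thesis
      using contracted_extend[OF r rope_arc[OF r'] sr(1,2)] un r' unfolding uncontracted_def sr(3,4) by auto
  qed
qed

lemma theta_subset_cong: "\<theta> \<subseteq> cong (uncontracted \<theta>)"
proof clarify
  fix R S assume RS: "(R, S) \<in> \<theta>"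
  show "(R, S) \<in> cong (uncontracted \<theta>)"
  proof (rule congI)
    fix u v N T assume "(u, v, N, T) \<in> uncontracted \<theta>"
    then show "jirr u v N T \<subseteq> R \<longleftrightarrow> jirr u v N T \<subseteq> S"
      using contracted_jirr[OF _ RS, of u v N T] contracted_jirr[OF _ theta_sym[OF RS], of u v N T]
      unfolding uncontracted_def by blast
  qed (use theta_biclosed[OF RS] in simp_all)
qed

text \<open>For \<open>S\<close> below \<open>R\<close>, climb from \<open>S\<close> to
  \<open>R\<close> by joining separating join irreducibles: a rope that separates two elements
  identified by \<open>cong\<close> is contracted, so each step stays in one class of
  \<open>\<theta>\<close>.\<close>

lemma cong_subset_theta:
  assumes "(R, S) \<in> cong (uncontracted \<theta>)"
  shows "(R, S) \<in> \<theta>"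
proof -
  let ?I = "uncontracted \<theta>"
  have up: "(S, R) \<in> \<theta>" if "(S, R) \<in> cong ?I" "S \<subseteq> R" for S R
    using that
  proof (induction "card (R - S)" arbitrary: S rule: less_induct)
    case less
    have R: "biclosed R" and S: "biclosed S" using less.prems by (auto simp: cong_def)
    show ?case
    proof (cases "R \<subseteq> S")
      case True
      then show ?thesis using less.prems(2) theta_refl[OF S] by (simp add: subset_antisym)
    next
      case False
      obtain u v N T where r: "is_rope u v N T" and JR: "jirr u v N T \<subseteq> R"
        and uvS: "(u, v) \<notin> S" and JS: "jirr u v N T - {(u, v)} \<subseteq> S"
        using separating_rope[OF R S False] by blast
      let ?J = "jirr u v N T"
      have uvJ: "(u, v) \<in> ?J" using arc_in_jirr[OF rope_arc[OF r]] .
      have "(u, v, N, T) \<notin> ?I"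
        using congD[OF less.prems(1)] JR uvS uvJ by blast
      then have "(?J, ?J - {(u, v)}) \<in> \<theta>"
        using r by (simp add: uncontracted_def)
      then have "(?J \<squnion>\<^bsub>AR\<^esub> S, S) \<in> \<theta>"
        using theta_join[of ?J "?J - {(u, v)}" S] S join_absorb[OF biclosed_jirr_lower[OF r] S JS] by simp
      then have SJ: "(S, ?J \<squnion>\<^bsub>AR\<^esub> S) \<in> \<theta>" by (rule theta_sym)
      have J: "biclosed ?J" using biclosed_jirr[OF r] .
      have sub: "?J \<squnion>\<^bsub>AR\<^esub> S \<subseteq> R" "?J \<subseteq> ?J \<squnion>\<^bsub>AR\<^esub> S" "S \<subseteq> ?J \<squnion>\<^bsub>AR\<^esub> S"
        using join_subset_iff[OF J S R] JR less.prems(2) AR.join_left[of ?J S] AR.join_right[of ?J S] J S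
        by auto
      have "finite R" using biclosed_subset[OF R] finite_arcs finite_subset by blast
      then have "card (R - (?J \<squnion>\<^bsub>AR\<^esub> S)) < card (R - S)"
        using sub uvS uvJ by (intro psubset_card_mono) auto
      moreover have "(?J \<squnion>\<^bsub>AR\<^esub> S, R) \<in> cong ?I"
        using SJ theta_subset_cong cong_sym cong_trans less.prems(1) by blast
      ultimately have "(?J \<squnion>\<^bsub>AR\<^esub> S, R) \<in> \<theta>"
        using less.hyps sub(1) by blast
      then show ?thesis using SJ theta_trans by blast
    qed
  qed
  have R: "biclosed R" and S: "biclosed S" using assms by (auto simp: cong_def)
  \<comment> \<open>Incomparable elements are linked through their meet, which
    \<open>cong_meet\<close> shows to be congruent to both.\<close>
  note I = uncontracted_ideal
  have RR: "(R, R) \<in> cong ?I" and SS: "(S, S) \<in> cong ?I" using R S by (auto simp: cong_def)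
  have idem: "R \<sqinter>\<^bsub>AR\<^esub> R = R" "S \<sqinter>\<^bsub>AR\<^esub> S = S" using meet_absorb R S by auto
  have "(R \<sqinter>\<^bsub>AR\<^esub> S, R) \<in> cong ?I"
    using cong_meet[OF I RR cong_sym[OF assms]] idem by simp
  moreover have "(R \<sqinter>\<^bsub>AR\<^esub> S, S) \<in> cong ?I"
    using cong_meet[OF I assms SS] idem by simp
  moreover have "R \<sqinter>\<^bsub>AR\<^esub> S \<subseteq> R" "R \<sqinter>\<^bsub>AR\<^esub> S \<subseteq> S"
    using AR.meet_left[of R S] AR.meet_right[of R S] R S by auto
  ultimately show ?thesis
    using theta_trans[OF theta_sym[OF up] up] by blast
qed

lemma cong_uncontracted: "cong (uncontracted \<theta>) = \<theta>"
  using theta_subset_cong cong_subset_theta by auto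

end

section \<open>The order isomorphism between congruences and ideals\<close>

text \<open>Test on the pair of a join irreducible and its lower cover: a rope of \<open>I\<close>
  separates its own pair, so some rope of \<open>K\<close> does, and by \<open>jirr_inject\<close>
  it is the same rope.\<close>

lemma ideal_subset_if_cong_subset:
  assumes I: "I \<in> ideals" and K: "K \<in> ideals" and sub: "cong K \<subseteq> cong I"
  shows "I \<subseteq> K"
proof clarify
  fix u v N T assume \<rho>: "(u, v, N, T) \<in> I"
  have r: "is_rope u v N T" using ideal_rope[OF I \<rho>] .
  let ?J = "jirr u v N T" and ?J' = "jirr u v N T - {(u, v)}"
  have uv: "(u, v) \<in> ?J" using arc_in_jirr[OF rope_arc[OF r]] .
  have "(?J, ?J') \<notin> cong I"
    using congD[of ?J ?J' I, OF _ \<rho>] uv by blast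
  then have "(?J, ?J') \<notin> cong K" using sub by blast
  then obtain x y N' T' where \<sigma>: "(x, y, N', T') \<in> K" "jirr x y N' T' \<subseteq> ?J" "\<not> jirr x y N' T' \<subseteq> ?J'"
    using congI[OF biclosed_jirr[OF r] biclosed_jirr_lower[OF r], of K] by blast
  then show "(u, v, N, T) \<in> K"
    using jirr_inject[OF r ideal_rope[OF K \<sigma>(1)] \<sigma>(2)] by blast
qed

lemma cong_antimono:
  assumes "I \<subseteq> K"
  shows "cong K \<subseteq> cong I"
proof clarify
  fix R S assume RS: "(R, S) \<in> cong K"
  show "(R, S) \<in> cong I"
    using cong_biclosed[OF RS] congD[OF RS subsetD[OF assms]] by (intro congI) simp_all
qed

lemma cong_subset_iff: "I \<in> ideals \<Longrightarrow> K \<in> ideals \<Longrightarrow> cong K \<subseteq> cong I \<longleftrightarrow> I \<subseteq> K"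
  using ideal_subset_if_cong_subset cong_antimono by blast

theorem congruence_lattice_AR:
  "order_isomorphic (congruence_lattice AR) \<lparr> carrier = ideals, eq = (=), le = (\<supseteq>) \<rparr>"
  unfolding order_isomorphic_def
proof (intro exI conjI)
  show "bij_betw uncontracted (carrier (congruence_lattice AR)) (carrier \<lparr> carrier = ideals, eq = (=), le = (\<supseteq>) \<rparr>)"
  proof (rule bij_betw_byWitness[where f' = cong])
    show "\<forall>\<theta>\<in>carrier (congruence_lattice AR). cong (uncontracted \<theta>) = \<theta>"
      using cong_uncontracted by (simp add: congruence_lattice_def)
    \<comment> \<open>Both ideals have the same congruence, and \<open>cong_subset_iff\<close> makes
      \<open>cong\<close> injective on ideals.\<close>
    show "\<forall>I\<in>carrier \<lparr> carrier = ideals, eq = (=), le = (\<supseteq>) \<rparr>. uncontracted (cong I) = I"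
      using cong_uncontracted[OF congruence_cong] uncontracted_ideal[OF congruence_cong] cong_subset_iff
      by (metis partial_object.select_convs(1) order_refl subset_antisym)
    show "uncontracted ` carrier (congruence_lattice AR) \<subseteq> carrier \<lparr> carrier = ideals, eq = (=), le = (\<supseteq>) \<rparr>"
      using uncontracted_ideal by (auto simp: congruence_lattice_def)
    show "cong ` carrier \<lparr> carrier = ideals, eq = (=), le = (\<supseteq>) \<rparr> \<subseteq> carrier (congruence_lattice AR)"
      using congruence_cong by (auto simp: congruence_lattice_def)
  qed
  have "weak_partial_order (congruence_lattice AR)"
    by unfold_locales (auto simp: congruence_lattice_def)
  moreover have "weak_partial_order \<lparr> carrier = ideals, eq = (=), le = (\<supseteq>) \<rparr>"
    by unfold_locales auto
  moreover have "uncontracted \<theta> \<supseteq> uncontracted \<theta>' \<longleftrightarrow> \<theta> \<subseteq> \<theta>'"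
    if "lattice_congruence AR \<theta>" "lattice_congruence AR \<theta>'" for \<theta> \<theta>'
    using cong_subset_iff[OF uncontracted_ideal[OF that(2)] uncontracted_ideal[OF that(1)]]
      cong_uncontracted that by simp
  ultimately show "order_emb (congruence_lattice AR) \<lparr> carrier = ideals, eq = (=), le = (\<supseteq>) \<rparr> uncontracted"
    by (simp add: order_emb_def congruence_lattice_def)
qed

end

section \<open>Skeletal graphs have skeletal arc sets\<close>

text \<open>Turns walks into sorted lists: reachability can be read off positions, and acyclicity
  gives distinctness.\<close>

lemma vwalk_arcs_sorted:
  "set (vwalk_arcs p) \<subseteq> A \<Longrightarrow> sorted_wrt (\<lambda>a b. (a, b) \<in> A\<^sup>+) p"
proof (induction p rule: vwalk_arcs.induct)
  case (3 x y xs)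
  then have "(x, y) \<in> A" and IH: "sorted_wrt (\<lambda>a b. (a, b) \<in> A\<^sup>+) (y # xs)" by auto
  then show ?case by (auto intro: trancl_into_trancl2)
qed auto

lemma acyclic_sorted_distinct:
  "acyclic A \<Longrightarrow> sorted_wrt (\<lambda>a b. (a, b) \<in> A\<^sup>+) p \<Longrightarrow> distinct p"
  by (induction p) (auto simp: acyclic_def)

lemma vwalk_extend:
  assumes "pair_wf_digraph D" "(u, w) \<in> (parcs D)\<^sup>*" "vwalk q (with_proj D)" "hd q = w"
  shows "\<exists>p. vwalk p (with_proj D) \<and> hd p = u \<and> last p = last q \<and> set q \<subseteq> set p"
  using assms(2)
proof (induction rule: converse_rtrancl_induct)
  case base
  then show ?case using assms(3,4) by blast
next
  case (step x y)
  then obtain p where p: "vwalk p (with_proj D)" "hd p = y" "last p = last q" "set q \<subseteq> set p" by blast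
  have "x \<in> pverts D" using step(1) pair_wf_digraph.in_arcsD1[OF assms(1)] by blast
  then have "vwalk (x # p) (with_proj D)"
    using p step(1) by (intro vwalk_consI) auto
  moreover have "p \<noteq> []" using p(1) by (simp add: vwalk_def)
  ultimately show ?case using p by (intro exI[of _ "x # p"]) auto
qed

lemma directed_path_trancl:
  assumes "directed_path D u p v" "w \<in> set p"
  shows "w = u \<or> (u, w) \<in> (parcs D)\<^sup>+" "w = v \<or> (w, v) \<in> (parcs D)\<^sup>+"
proof -
  have p: "sorted_wrt (\<lambda>a b. (a, b) \<in> (parcs D)\<^sup>+) p" "p \<noteq> []" "hd p = u" "last p = v"
    using assms(1) vwalk_arcs_sorted by (auto simp: directed_path_def vpath_def vwalk_def)
  show "w = u \<or> (u, w) \<in> (parcs D)\<^sup>+"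
    using p assms(2) by (cases p) auto
  show "w = v \<or> (w, v) \<in> (parcs D)\<^sup>+"
    using p assms(2) by (cases p rule: rev_cases) (auto simp: sorted_wrt_append)
qed

lemma directed_path_ends:
  "directed_path D u p v \<Longrightarrow> p ! 0 = u \<and> p ! (length p - 1) = v"
  by (auto simp: directed_path_def vpath_def vwalk_def hd_conv_nth last_conv_nth)

text \<open>The walk is built backwards from \<open>[v]\<close>, first to \<open>w\<close> and then
  to \<open>u\<close>; acyclicity makes it a path.\<close>

lemma directed_path_through:
  assumes "dag D" "(u, v) \<in> parcs D" "(u, w) \<in> (parcs D)\<^sup>*" "(w, v) \<in> (parcs D)\<^sup>*"
  obtains p where "directed_path D u p v" "w \<in> set p"
proof -
  have wf: "pair_wf_digraph D" and acyc: "acyclic (parcs D)"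
    using assms(1) by (auto simp: dag_def pair_digraph_def pair_fin_digraph_def)
  have "v \<in> pverts D"
    using assms(2) pair_wf_digraph.in_arcsD2[OF wf] by blast
  then have "vwalk [v] (with_proj D)" by (simp add: vwalk_def)
  then obtain q where q: "vwalk q (with_proj D)" "hd q = w" "last q = v"
    using vwalk_extend[OF wf assms(4), of "[v]"] by auto
  then obtain p where p: "vwalk p (with_proj D)" "hd p = u" "last p = v" "set q \<subseteq> set p"
    using vwalk_extend[OF wf assms(3) q(1,2)] by auto
  have "distinct p"
    using p(1) by (auto simp: vwalk_def intro: acyclic_sorted_distinct[OF acyc vwalk_arcs_sorted])
  moreover have "w \<in> set p"
    using q p(4) by (metis hd_in_set subsetD vwalkE)
  ultimately show ?thesis
    using that p by (auto simp: directed_path_def)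
qed

lemma filled_between:
  assumes D: "dag D" "filled D" and uv: "(u, v) \<in> parcs D"
    and w: "(u, w) \<in> (parcs D)\<^sup>+" "(w, v) \<in> (parcs D)\<^sup>+"
  shows "(u, w) \<in> parcs D \<and> (w, v) \<in> parcs D"
proof -
  obtain p where p: "directed_path D u p v" "w \<in> set p"
    using directed_path_through[OF D(1) uv w[THEN trancl_into_rtrancl]] .
  have arcs: "\<And>i j. i < j \<Longrightarrow> j < length p \<Longrightarrow> (p ! i, p ! j) \<in> parcs D"
    using D(2) p(1) uv unfolding filled_def by blast
  obtain k where k: "k < length p" "w = p ! k"
    using p(2) by (auto simp: in_set_conv_nth)
  have ends: "p ! 0 = u" "p ! (length p - 1) = v"
    using directed_path_ends[OF p(1)] by simp_all
  have "w \<noteq> u" "w \<noteq> v"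
    using w D(1) by (auto simp: dag_def acyclic_def)
  then have "k \<noteq> 0" "k \<noteq> length p - 1"
    using ends k(2) by metis+
  then have "0 < k" "k < length p - 1"
    using k(1) by linarith+
  then show ?thesis
    using arcs[of 0 k] arcs[of k "length p - 1"] ends k by simp
qed

section \<open>Undirected cycles in skeletal graphs\<close>

lemma pcas_map: "a \<le> b \<Longrightarrow> pcas (f a) (map (\<lambda>i. (f i, f (Suc i))) [a..<b]) (f b)"
  by (induction a rule: inc_induct) (auto simp: upt_conv_Cons)

lemma pawalk_verts_map:
  "a \<le> b \<Longrightarrow> pawalk_verts (f a) (map (\<lambda>i. (f i, f (Suc i))) [a..<b]) = map f [a..<Suc b]"
  by (induction a rule: inc_induct) (auto simp: upt_conv_Cons)

text \<open>If no edge of an undirected cycle is the long edge of a triangle on vertices of the cycle,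
  then the cycle survives in the transitive reduction of the subgraph it induces.\<close>

lemma vertebrate_no_cycle:
  assumes D: "dag D" "skeletal D" and n: "3 \<le> n" and inj: "inj_on f {..<n}" and closed: "f n = f 0"
    and edges: "\<And>i. i < n \<Longrightarrow> (f i, f (Suc i)) \<in> parcs D \<or> (f (Suc i), f i) \<in> parcs D"
    and short: "\<And>i k. \<lbrakk>i < n; k < n; (f i, f k) \<in> parcs D\<rbrakk> \<Longrightarrow> (f k, f (Suc i)) \<notin> parcs D"
      "\<And>i k. \<lbrakk>i < n; k < n; (f (Suc i), f k) \<in> parcs D\<rbrakk> \<Longrightarrow> (f k, f i) \<notin> parcs D"
  shows False
proof -
  define S where "S = f ` {..<n}"
  define H where "H = \<lparr> pverts = S, parcs = parcs D \<inter> S \<times> S \<rparr>"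
  have wf: "pair_wf_digraph D"
    using D(1) by (auto simp: dag_def pair_digraph_def pair_fin_digraph_def)
  have SD: "S \<subseteq> pverts D"
    using edges pair_wf_digraph.in_arcsD1[OF wf] pair_wf_digraph.in_arcsD2[OF wf] by (fastforce simp: S_def)
  have fS: "f i \<in> S" if "i \<le> n" for i
    using that n closed by (cases "i = n") (auto simp: S_def)
  have "pair_wf_digraph H"
    by unfold_locales (auto simp: H_def)
  then have wf': "wf_digraph (with_proj D)" "wf_digraph (with_proj H)"
    using wf by (auto simp: pair_wf_digraph_def wf_digraph_def)
  have "induced_subgraph (with_proj H) (with_proj D)"
    unfolding induced_subgraph_def subgraph_def using SD wf' by (auto simp: H_def)
  then have forest: "underlying_forest (transitive_reduction H)"
    using D(2) unfolding skeletal_def vertebrate_def by blast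
  \<comment> \<open>A longer path from \<open>a\<close> to \<open>b\<close> would, by filledness,
    make its second vertex the middle of a triangle over \<open>(a, b)\<close>, and this vertex lies
    on the cycle.\<close>
  have kept: "(a, b) \<in> parcs (transitive_reduction H)"
    if ab: "(a, b) \<in> parcs D" "a \<in> S" "b \<in> S"
      and no: "\<And>k. k < n \<Longrightarrow> (a, f k) \<in> parcs D \<Longrightarrow> (f k, b) \<notin> parcs D" for a b
  proof -
    have False if p: "directed_path H a p b" and len: "2 \<le> vwalk_length p" for p
    proof -
      have pS: "set p \<subseteq> S" and "directed_path D a p b"
        using p SD by (auto simp: directed_path_def vpath_def vwalk_def H_def)
      then have arcs: "\<And>i j. i < j \<Longrightarrow> j < length p \<Longrightarrow> (p ! i, p ! j) \<in> parcs D"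
        using D(2) ab(1) unfolding skeletal_def filled_def by blast
      have len': "2 < length p" using len by simp
      then have "p ! 0 = a" "p ! (length p - 1) = b"
        using directed_path_ends[OF p] by simp_all
      then have "(a, p ! 1) \<in> parcs D" "(p ! 1, b) \<in> parcs D"
        using arcs[of 0 1] arcs[of 1 "length p - 1"] len' by auto
      moreover have "p ! 1 \<in> S" using pS len' by (meson nth_mem subsetD less_trans one_less_numeral_iff semiring_norm(76))
      ultimately show False using no by (auto simp: S_def)
    qed
    then show ?thesis
      using ab by (auto simp: transitive_reduction_def H_def)
  qed
  let ?G = "with_proj (mk_symmetric (with_proj (transitive_reduction H)))"
  let ?c = "map (\<lambda>i. (f i, f (Suc i))) [0..<n]"
  have "(f i, f (Suc i)) \<in> parcs (mk_symmetric (with_proj (transitive_reduction H)))" if i: "i < n" for i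
    using edges[OF i]
  proof
    assume "(f i, f (Suc i)) \<in> parcs D"
    then have "(f i, f (Suc i)) \<in> parcs (transitive_reduction H)"
      using kept short(1)[OF i] fS[of i] fS[of "Suc i"] i by simp
    then show ?thesis
      unfolding parcs_mk_symmetric by (intro UN_I[of "(f i, f (Suc i))"]) simp_all
  next
    assume "(f (Suc i), f i) \<in> parcs D"
    then have "(f (Suc i), f i) \<in> parcs (transitive_reduction H)"
      using kept short(2)[OF i] fS[of i] fS[of "Suc i"] i by simp
    then show ?thesis
      unfolding parcs_mk_symmetric by (intro UN_I[of "(f (Suc i), f i)"]) simp_all
  qed
  then have "set ?c \<subseteq> arcs ?G" by auto
  moreover have "f 0 \<in> verts ?G"
    using fS[of 0] by (simp add: transitive_reduction_def H_def)
  moreover have "pre_digraph.cas ?G (f 0) ?c (f 0)"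
    using pcas_map[of 0 n f] closed by (simp add: cas_with_proj_eq)
  moreover have "distinct (tl (pre_digraph.awalk_verts ?G (f 0) ?c))"
  proof -
    \<comment> \<open>\<open>tl\<close> drops the start \<open>f 0\<close>, which returns as
      \<open>f n\<close>, so the indices are shifted by one.\<close>
    have "inj_on f {1..<Suc n}"
    proof (rule inj_onI)
      fix i j assume "i \<in> {1..<Suc n}" "j \<in> {1..<Suc n}" "f i = f j"
      then show "i = j"
        using inj_onD[OF inj, of i j] inj_onD[OF inj, of i 0] inj_onD[OF inj, of 0 j] closed
        by (cases "i = n"; cases "j = n") auto
    qed
    then show ?thesis
      using pawalk_verts_map[of 0 n f] by (simp add: awalk_verts_with_proj_eq distinct_map flip: map_tl del: upt_Suc)
  qed
  moreover have "3 \<le> length ?c" using n by simp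
  ultimately have "pre_digraph.cycle ?G ?c"
    unfolding pre_digraph.cycle_def pre_digraph.awalk_def using n by (intro exI[of _ "f 0"]) auto
  then show False
    using forest n unfolding underlying_forest_def by fastforce
qed

lemma skeletal_arcs_parcs:
  assumes D: "dag D" "skeletal D"
  shows "skeletal_arcs (parcs D)"
proof
  show "finite (parcs D)"
    using D(1) by (simp add: dag_def pair_digraph_def pair_fin_digraph_def pair_fin_digraph_axioms_def)
  show acyc: "acyclic (parcs D)"
    using D(1) by (simp add: dag_def)
  show "(u, w) \<in> parcs D \<and> (w, v) \<in> parcs D"
    if "(u, v) \<in> parcs D" "(u, w) \<in> (parcs D)\<^sup>+" "(w, v) \<in> (parcs D)\<^sup>+" for u v w
    using filled_between[OF D(1) _ that] D(2) by (simp add: skeletal_def)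
  fix u v w w'
  assume A: "(u, v) \<in> parcs D" "(u, w) \<in> parcs D" "(w, v) \<in> parcs D" "(u, w') \<in> parcs D" "(w', v) \<in> parcs D" "w \<noteq> w'"
  show "(w, w') \<in> parcs D \<or> (w', w) \<in> parcs D"
  proof (rule ccontr)
    assume no: "\<not> ?thesis"
    have loop: "(a, a) \<notin> parcs D" for a
      using acyc by (auto simp: acyclic_def)
    have asym: "(a, b) \<in> parcs D \<Longrightarrow> (b, a) \<notin> parcs D" for a b
      using acyc unfolding acyclic_def by (meson r_into_trancl trancl_trans)
    \<comment> \<open>The 4-cycle \<open>u\<close>, \<open>w\<close>, \<open>v\<close>,
      \<open>w'\<close>; the fifth entry closes it. Its only chord \<open>(u, v)\<close> is the long
      edge of every triangle on these vertices.\<close>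
    let ?f = "\<lambda>i. [u, w, v, w', u] ! i"
    have lt4: "i < 4 \<longleftrightarrow> i = 0 \<or> i = 1 \<or> i = 2 \<or> i = (3::nat)" for i by auto
    have non_arcs: "(w, u) \<notin> parcs D" "(v, w) \<notin> parcs D" "(w', u) \<notin> parcs D" "(v, w') \<notin> parcs D"
      "(v, u) \<notin> parcs D" "(w, w') \<notin> parcs D" "(w', w) \<notin> parcs D" "(a, a) \<notin> parcs D" for a
      using A no asym loop by auto
    have ne: "u \<noteq> w" "u \<noteq> v" "u \<noteq> w'" "w \<noteq> v" "w' \<noteq> v"
      using A loop by auto
    show False
    proof (rule vertebrate_no_cycle[OF D, of 4 ?f])
      show "inj_on ?f {..<4}"
        using ne A(6) by (auto simp: inj_on_def lt4)
    qed (auto simp: lt4 A non_arcs)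
  qed
qed

section \<open>Acyclic reorientations as biclosed sets\<close>

text \<open>Biclosed means that no triangle becomes a directed cycle. A shortest directed cycle of
  the reorientation has no chord, and \<open>vertebrate_no_cycle\<close> excludes chordless cycles
  of length at least 4.\<close>

lemma acyclic_reorient_iff:
  assumes D: "dag D" "skeletal D" and R: "R \<subseteq> parcs D"
  shows "acyclic (parcs (reorient D R)) \<longleftrightarrow> skeletal_arcs.biclosed (parcs D) R"
proof -
  interpret skeletal_arcs "parcs D" by (rule skeletal_arcs_parcs[OF D])
  define B where "B = (parcs D - R) \<union> R\<inverse>"
  have B_edge: "(a, b) \<in> parcs D \<or> (b, a) \<in> parcs D" if "(a, b) \<in> B" for a b
    using that R by (auto simp: B_def)
  have edge_B: "(a, b) \<in> B \<or> (b, a) \<in> B" if "(a, b) \<in> parcs D \<or> (b, a) \<in> parcs D" for a b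
    using that by (auto simp: B_def)
  have B_loop: "(a, a) \<notin> B" for a
    using B_edge not_loop by blast
  have B_asym: "(b, a) \<notin> B" if "(a, b) \<in> B" for a b
    using that R asym_arcs unfolding B_def by blast
  have "biclosed R" if acyc: "acyclic B"
  proof (rule biclosedI)
    have no3: False if "(a, b) \<in> B" "(b, c) \<in> B" "(c, a) \<in> B" for a b c
    proof -
      have "(a, a) \<in> B\<^sup>+"
        using that by (meson r_into_trancl trancl_into_trancl)
      then show False using acyc by (simp add: acyclic_def)
    qed
    show "(a, c) \<in> R" if "(a, c) \<in> parcs D" "b \<in> mid a c" "(a, b) \<in> R" "(b, c) \<in> R" for a b c
      using no3[of a c b] that by (auto simp: B_def)
    show "(a, b) \<in> R \<or> (b, c) \<in> R" if "(a, c) \<in> R" "b \<in> mid a c" for a b c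
      using no3[of a b c] that by (auto simp: B_def mid_def)
  qed (use R in simp)
  moreover have "acyclic B" if R': "biclosed R"
  proof (rule ccontr)
    assume "\<not> acyclic B"
    then have "\<exists>n. 0 < n \<and> (\<exists>x. (x, x) \<in> B ^^ n)"
      by (auto simp: acyclic_def trancl_power)
    then obtain n where n: "0 < n" "\<exists>x. (x, x) \<in> B ^^ n"
      and min: "\<And>m. 0 < m \<Longrightarrow> \<exists>x. (x, x) \<in> B ^^ m \<Longrightarrow> n \<le> m"
      using exists_least_iff[of "\<lambda>n. 0 < n \<and> (\<exists>x. (x, x) \<in> B ^^ n)"] by (metis not_le)
    then obtain f where f: "f n = f 0" "\<And>i. i < n \<Longrightarrow> (f i, f (Suc i)) \<in> B"
      by (auto simp: relpow_fun_conv)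
    have seg: "(f i, f j) \<in> B ^^ (j - i)" if "i \<le> j" "j \<le> n" for i j
      unfolding relpow_fun_conv using that f(2) by (intro exI[of _ "\<lambda>k. f (i + k)"]) auto
    have inj: "inj_on f {..<n}"
    proof (rule linorder_inj_onI)
      fix i j assume "i < j" "i \<in> {..<n}" "j \<in> {..<n}"
      then show "f i \<noteq> f j"
        using min[of "j - i"] seg[of i j] by fastforce
    qed auto
    \<comment> \<open>Whichever way a chord is oriented in \<open>B\<close>, it closes a shorter
      directed cycle with part of the given one, against minimality of \<open>n\<close>.\<close>
    have chord: "j = Suc i \<or> i = 0 \<and> j = n - 1"
      if ij: "i < j" "j < n" and e: "(f i, f j) \<in> parcs D \<or> (f j, f i) \<in> parcs D" for i j
      using edge_B[OF e]
    proof
      assume b: "(f i, f j) \<in> B"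
      have "(f 0, f j) \<in> B ^^ Suc i"
        using seg[of 0 i] ij b by auto
      then have "(f 0, f 0) \<in> B ^^ (Suc i + (n - j))"
        using seg[of j n] ij f(1) unfolding relpow_add by (auto simp del: relpow.simps)
      then have "n \<le> Suc i + (n - j)" by (intro min) auto
      then show ?thesis using ij by linarith
    next
      assume "(f j, f i) \<in> B"
      then have "(f i, f i) \<in> B ^^ Suc (j - i)"
        using seg[of i j] ij by auto
      then have "n \<le> Suc (j - i)" by (intro min) auto
      then show ?thesis using ij by linarith
    qed
    have "n \<noteq> 1" using f B_loop by (metis One_nat_def n(1))
    moreover have "n \<noteq> 2" using f(1) f(2)[of 0] f(2)[of 1] B_asym by (auto simp: numeral_2_eq_2)
    moreover have "n \<noteq> 3"
    proof
      assume "n = 3"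
      then have t: "(f 0, f 1) \<in> B" "(f 1, f 2) \<in> B" "(f 2, f 0) \<in> B"
        using f(1) f(2)[of 0] f(2)[of 1] f(2)[of 2] by (auto simp: numeral_2_eq_2 numeral_3_eq_3)
      \<comment> \<open>By number of reversed arcs in the triangle: closedness excludes two,
        coclosedness one, and acyclicity of \<open>D\<close> none or all three.\<close>
      have cl: "\<And>a b c. (a, c) \<in> parcs D - R \<Longrightarrow> (a, b) \<in> R \<Longrightarrow> (b, c) \<notin> R"
        using biclosed_closed[OF R'] by blast
      have co: "\<And>a b c. (a, c) \<in> R \<Longrightarrow> (a, b) \<in> parcs D - R \<Longrightarrow> (b, c) \<notin> parcs D - R"
        using biclosed_coclosed[OF R'] by (auto simp: mid_def)
      have c3: "\<And>a b c. (a, b) \<in> R \<Longrightarrow> (b, c) \<in> R \<Longrightarrow> (c, a) \<notin> R"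
        using R no_3cycle by blast
      show False
        using t cl co c3 no_3cycle unfolding B_def by blast
    qed
    ultimately have n4: "4 \<le> n" using n(1) by linarith
    have adj: "k = Suc i \<or> i = Suc k \<or> i = 0 \<and> k = n - 1 \<or> k = 0 \<and> i = n - 1"
      if "i < n" "k < n" "(f i, f k) \<in> parcs D \<or> (f k, f i) \<in> parcs D" for i k
      using chord[of i k] chord[of k i] that not_loop by (cases i k rule: linorder_cases) auto
    \<comment> \<open>Without chords, \<open>f k\<close> would be a cyclic neighbour of two
      consecutive vertices, impossible for \<open>4 <= n\<close>. The case \<open>Suc i = n\<close>
      wraps around to index 0.\<close>
    have common: False
      if ik: "i < n" "k < n" and e: "(f i, f k) \<in> parcs D \<or> (f k, f i) \<in> parcs D"
        "(f (Suc i), f k) \<in> parcs D \<or> (f k, f (Suc i)) \<in> parcs D" for i k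
    proof (cases "Suc i = n")
      case True
      then show False
        using adj[OF ik e(1)] adj[of 0 k] e(2) ik n4 f(1) by auto
    next
      case False
      then show False
        using adj[OF ik e(1)] adj[of "Suc i" k] e(2) ik n4 by auto
    qed
    show False
      by (rule vertebrate_no_cycle[OF D _ inj f(1)]) (use n4 f(2) B_edge common in \<open>blast | linarith\<close>)+
  qed
  ultimately show ?thesis
    by (auto simp: reorient_def B_def)
qed

theorem corollary38:
  fixes D :: "'a pair_pre_digraph"
  assumes "dag D" and "skeletal D"
  shows "order_isomorphic (congruence_lattice (acyclic_reorientations D)) (rope_ideal_lattice D)"
proof -
  interpret skeletal_arcs "parcs D" by (rule skeletal_arcs_parcs[OF assms])
  have "acyclic_reorientations D = AR"
    unfolding acyclic_reorientations_def AR_def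
    using acyclic_reorient_iff[OF assms] biclosed_subset by auto
  \<comment> \<open>The path-based support agrees with \<open>mid\<close> on arcs: filledness
    shortens paths to two arcs, and conversely two arcs form a path.\<close>
  moreover have support: "transitive_support D u v - {u, v} = mid u v" if uv: "(u, v) \<in> parcs D" for u v
  proof (rule equalityI; rule subsetI)
    fix w assume "w \<in> transitive_support D u v - {u, v}"
    then obtain p where p: "directed_path D u p v" "w \<in> set p" and ne: "w \<noteq> u" "w \<noteq> v"
      by (auto simp: transitive_support_def)
    show "w \<in> mid u v"
      using directed_path_trancl[OF p] ne filled_arcs[OF uv, of w] by (simp add: mid_def)
  next
    fix w assume w: "w \<in> mid u v"
    then obtain p where "directed_path D u p v" "w \<in> set p"
      using directed_path_through[OF assms(1) uv, of w] by (auto simp: mid_def)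
    then show "w \<in> transitive_support D u v - {u, v}"
      using w not_loop by (auto simp: transitive_support_def mid_def)
  qed
  have "(u, v, N, T) \<in> ropes D \<longleftrightarrow> (u, v, N, T) \<in> all_ropes" for u v N T
    using support[of u v] by (cases "(u, v) \<in> parcs D") (simp_all add: ropes_def all_ropes_def is_rope_def)
  then have "ropes D = all_ropes"
    by (simp add: set_eq_iff split_paired_All)
  then have "rope_ideal_lattice D = \<lparr> carrier = ideals, eq = (=), le = (\<supseteq>) \<rparr>"
    by (simp add: rope_ideal_lattice_def rope_lower_ideals_def ideals_def)
  ultimately show ?thesis
    using congruence_lattice_AR by simp
qed

end
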